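(* Let $X$ be a non-empty compact Hausdorff space, $\sigma:X\to X$ a homeomorphism, and $\Sigma=(X,\sigma)$. The following are equivalent: (1) Every closed ideal of $\ell^1(\Sigma)$ is self-adjoint; (2) $\Sigma$ is free.
   Context: Let $\alpha$ be the automorphism of $C(X)$ (continuous complex-valued functions with supremum norm $\|\cdot\|_\infty$) given by $\alpha(f)=f\circ\sigma^{-1}$. The unital Banach $^*$-algebra $\ell^1(\Sigma)$ is the Banach space $\{a:\mathbb Z\to C(X) : \|a\|=\sum_{k\in\mathbb Z}\|a(k)\|_\infty<\infty\}$ with pointwise linear operations, product $(ab)(n)=\sum_{k\in\mathbb Z}a(k)\cdot\alpha^k(b(n-k))$ and involution $a^*(n)=\overline{\alpha^n(a(-n))}$. Ideals are two-sided. An ideal $I$ is self-adjoint if $a^*\in I$ for all $a\in I$. $\Sigma$ is free if every point of $X$ is aperiodic, i.e. $\sigma^n(x)\neq x$ for all $x\in X$ and all $n\geq 1$. *)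

theory Defs
  imports "HOL-Analysis.Analysis"
begin

section \<open>The algebra \<open>C(X)\<close>\<close>

text \<open>
  The space \<open>X\<close> is the universe of a type, so that it is automatically non-empty. For compact \<open>X\<close>
  every continuous function is bounded, and \<open>C(X)\<close> with the supremum norm is the library type
  \<^typ>\<open>'a \<Rightarrow>\<^sub>C complex\<close> of bounded continuous functions.
\<close>

setup_lifting type_definition_bcontfun

lemma times_cont:
  fixes f g :: "'a::topological_space \<Rightarrow> 'b::real_normed_algebra"
  assumes "f \<in> bcontfun" "g \<in> bcontfun"
  shows "(\<lambda>x. f x * g x) \<in> bcontfun"
proof -
  obtain B C where BC: "\<And>x. norm (f x) \<le> B" "\<And>x. norm (g x) \<le> C"
    using assms by (auto simp: bcontfun_def bounded_iff)
  have "norm (f x * g x) \<le> B * C" for x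
    by (rule order_trans[OF norm_mult_ineq])
       (intro mult_mono BC norm_ge_zero order_trans[OF norm_ge_zero BC(1)])
  moreover have "continuous_on UNIV (\<lambda>x. f x * g x)"
    using assms by (auto simp: bcontfun_def intro!: continuous_intros)
  ultimately show ?thesis by (intro bcontfun_normI)
qed

instantiation bcontfun :: (topological_space, real_normed_algebra) real_normed_algebra
begin

lift_definition times_bcontfun :: "('a \<Rightarrow>\<^sub>C 'b) \<Rightarrow> ('a \<Rightarrow>\<^sub>C 'b) \<Rightarrow> 'a \<Rightarrow>\<^sub>C 'b"
  is "\<lambda>f g x. f x * g x"
  by (rule times_cont)

instance
proof
  fix f g :: "'a \<Rightarrow>\<^sub>C 'b"
  show "norm (f * g) \<le> norm f * norm g"
  proof (rule norm_bound)
    fix x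
    have "norm (f x * g x) \<le> norm (f x) * norm (g x)" by (rule norm_mult_ineq)
    also have "\<dots> \<le> norm f * norm g" by (intro mult_mono norm_bounded) auto
    finally show "norm (apply_bcontfun (f * g) x) \<le> norm f * norm g"
      by (simp add: times_bcontfun.rep_eq)
  qed
qed (auto intro!: bcontfun_eqI simp: times_bcontfun.rep_eq algebra_simps)

end

lift_definition cnj_bcontfun :: "('a::topological_space \<Rightarrow>\<^sub>C complex) \<Rightarrow> 'a \<Rightarrow>\<^sub>C complex"
  is "\<lambda>f x. cnj (f x)"
  by (auto simp: bcontfun_def bounded_iff intro!: continuous_intros)

text \<open>
  The library has completeness of \<^typ>\<open>'a \<Rightarrow>\<^sub>C 'b\<close> only for metric domains, and the arities conflict
  with a more general instance. Absolutely convergent sums are therefore treated by hand.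
\<close>

lemma apply_bcontfun_sum:
  fixes f :: "'i \<Rightarrow> 'a::topological_space \<Rightarrow>\<^sub>C 'b::real_normed_vector"
  shows "apply_bcontfun (sum f F) x = (\<Sum>k\<in>F. f k x)"
  by (induction F rule: infinite_finite_induct) auto

lemma abs_summable_bcontfun:
  fixes f :: "'i \<Rightarrow> 'a::topological_space \<Rightarrow>\<^sub>C 'b::banach"
  assumes "(\<lambda>k. norm (f k)) summable_on A"
  shows "f summable_on A"
    and "apply_bcontfun (infsum f A) x = (\<Sum>\<^sub>\<infinity>k\<in>A. f k x)"
proof -
  have "uniform_limit UNIV (\<lambda>F x. \<Sum>k\<in>F. f k x) (\<lambda>x. \<Sum>\<^sub>\<infinity>k\<in>A. f k x) (finite_subsets_at_top A)"
    by (rule Weierstrass_m_test_general[OF _ assms]) (rule norm_bounded)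
  then have "uniform_limit UNIV (\<lambda>F. apply_bcontfun (sum f F)) (\<lambda>x. \<Sum>\<^sub>\<infinity>k\<in>A. f k x)
      (finite_subsets_at_top A)"
    by (simp add: apply_bcontfun_sum[abs_def])
  then obtain g where g: "(\<lambda>x. \<Sum>\<^sub>\<infinity>k\<in>A. f k x) = apply_bcontfun g"
      "(sum f \<longlongrightarrow> g) (finite_subsets_at_top A)"
    by (rule uniform_limit_bcontfunE) auto
  then have "(f has_sum g) A" by (simp add: has_sum_def)
  then show "f summable_on A" by (rule has_sum_imp_summable)
  from \<open>(f has_sum g) A\<close> have "infsum f A = g" by (rule infsumI)
  then show "apply_bcontfun (infsum f A) x = (\<Sum>\<^sub>\<infinity>k\<in>A. f k x)"
    using fun_cong[OF g(1), of x] by simp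
qed

section \<open>The dynamical system\<close>

definition int_iterate :: "('b \<Rightarrow> 'b) \<Rightarrow> int \<Rightarrow> 'b \<Rightarrow> 'b" where
  "int_iterate f k = (if 0 \<le> k then f ^^ nat k else inv f ^^ nat (- k))"

definition free_system :: "('a \<Rightarrow> 'a) \<Rightarrow> bool" where
  "free_system \<sigma> \<longleftrightarrow> (\<forall>x. \<forall>n\<ge>1. (\<sigma> ^^ n) x \<noteq> x)"

definition alpha :: "('a::topological_space \<Rightarrow> 'a) \<Rightarrow> ('a \<Rightarrow>\<^sub>C complex) \<Rightarrow> 'a \<Rightarrow>\<^sub>C complex" where
  "alpha \<sigma> f = Bcontfun (apply_bcontfun f \<circ> inv \<sigma>)"

lemma apply_alpha:
  assumes "homeomorphism UNIV UNIV \<sigma> (inv \<sigma>)"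
  shows "apply_bcontfun (alpha \<sigma> f) x = f (inv \<sigma> x)"
proof -
  have "continuous_on UNIV (inv \<sigma>)"
    using assms by (simp add: homeomorphism_def)
  then have "continuous_on UNIV (\<lambda>x. f (inv \<sigma> x))"
    by (rule continuous_on_compose2[OF continuous_on_apply_bcontfun _ subset_UNIV])
  then have "(\<lambda>x. f (inv \<sigma> x)) \<in> bcontfun"
    by (rule bcontfun_normI[where b = "norm f"]) (rule norm_bounded)
  then show ?thesis
    by (simp add: alpha_def o_def Bcontfun_inverse)
qed

lemma bij_alpha:
  assumes "homeomorphism UNIV UNIV \<sigma> (inv \<sigma>)"
  shows "bij (alpha \<sigma>)"
proof -
  have inv: "inv \<sigma> (\<sigma> x) = x" "\<sigma> (inv \<sigma> x) = x" for x
    using assms by (auto simp: homeomorphism_def)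
  have b: "bij \<sigma>" using inv by (intro o_bij[of "inv \<sigma>"]) auto
  have hom': "homeomorphism UNIV UNIV (inv \<sigma>) (inv (inv \<sigma>))"
    using homeomorphism_symD[OF assms] by (simp add: inv_inv_eq[OF b])
  have "alpha (inv \<sigma>) (alpha \<sigma> f) = f" "alpha \<sigma> (alpha (inv \<sigma>) f) = f" for f
    by (rule bcontfun_eqI,
        simp only: apply_alpha[OF assms] apply_alpha[OF hom'] inv inv_inv_eq[OF b])+
  then have "alpha (inv \<sigma>) \<circ> alpha \<sigma> = id" "alpha \<sigma> \<circ> alpha (inv \<sigma>) = id"
    by (simp_all only: fun_eq_iff o_apply id_apply simp_thms)
  then show ?thesis by (rule o_bij)
qed

lemma apply_int_iterate_alpha:
  fixes \<sigma> :: "'a::topological_space \<Rightarrow> 'a"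
  assumes "homeomorphism UNIV UNIV \<sigma> (inv \<sigma>)"
  shows "apply_bcontfun (int_iterate (alpha \<sigma>) k f) x = apply_bcontfun f (int_iterate \<sigma> (- k) x)"
proof -
  have inv: "inv \<sigma> (\<sigma> x) = x" "\<sigma> (inv \<sigma> x) = x" for x
    using assms by (auto simp: homeomorphism_def)
  have pos: "apply_bcontfun ((alpha \<sigma> ^^ n) f) x = apply_bcontfun f ((inv \<sigma> ^^ n) x)" for n and f :: "'a \<Rightarrow>\<^sub>C complex" and x
  proof (induction n arbitrary: f)
    case (Suc n)
    have "(alpha \<sigma> ^^ Suc n) f = (alpha \<sigma> ^^ n) (alpha \<sigma> f)"
      by (simp only: funpow_Suc_right o_apply)
    then show ?case by (simp only: Suc apply_alpha[OF assms] funpow.simps o_apply)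
  qed simp
  have inv_alpha: "apply_bcontfun (inv (alpha \<sigma>) f) x = apply_bcontfun f (\<sigma> x)" for f x
  proof -
    have "alpha \<sigma> (inv (alpha \<sigma>) f) = f"
      using bij_alpha[OF assms] by (simp add: bij_is_surj surj_f_inv_f)
    then have "apply_bcontfun f (\<sigma> x) = apply_bcontfun (alpha \<sigma> (inv (alpha \<sigma>) f)) (\<sigma> x)" by simp
    also have "\<dots> = apply_bcontfun (inv (alpha \<sigma>) f) x"
      by (simp add: apply_alpha[OF assms] inv)
    finally show ?thesis ..
  qed
  have neg: "apply_bcontfun ((inv (alpha \<sigma>) ^^ n) f) x = apply_bcontfun f ((\<sigma> ^^ n) x)" for n and f :: "'a \<Rightarrow>\<^sub>C complex" and x
  proof (induction n arbitrary: f)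
    case (Suc n)
    have "(inv (alpha \<sigma>) ^^ Suc n) f = (inv (alpha \<sigma>) ^^ n) (inv (alpha \<sigma>) f)"
      by (simp only: funpow_Suc_right o_apply)
    then show ?case by (simp only: Suc inv_alpha funpow.simps o_apply)
  qed simp
  show ?thesis
    by (cases "k = 0") (auto simp: int_iterate_def pos neg)
qed

section \<open>The Banach \<open>*\<close>-algebra \<open>\<ell>\<^sup>1(\<Sigma>)\<close>\<close>

definition l1 :: "(int \<Rightarrow> 'a::topological_space \<Rightarrow>\<^sub>C complex) set" where
  "l1 = {a. (\<lambda>k. norm (a k)) summable_on UNIV}"

definition l1_norm :: "(int \<Rightarrow> 'a::topological_space \<Rightarrow>\<^sub>C complex) \<Rightarrow> real" where
  "l1_norm a = (\<Sum>\<^sub>\<infinity>k. norm (a k))"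

definition l1_dist ::
    "(int \<Rightarrow> 'a::topological_space \<Rightarrow>\<^sub>C complex) \<Rightarrow> (int \<Rightarrow> 'a \<Rightarrow>\<^sub>C complex) \<Rightarrow> real" where
  "l1_dist a b = l1_norm (\<lambda>k. a k - b k)"

text \<open>The sum over \<open>k\<close> below is an (absolutely convergent) sum in the Banach space \<open>C(X)\<close>.\<close>

definition l1_mult ::
    "('a::topological_space \<Rightarrow> 'a) \<Rightarrow> (int \<Rightarrow> 'a \<Rightarrow>\<^sub>C complex) \<Rightarrow> (int \<Rightarrow> 'a \<Rightarrow>\<^sub>C complex)
      \<Rightarrow> int \<Rightarrow> 'a \<Rightarrow>\<^sub>C complex" where
  "l1_mult \<sigma> a b n = (\<Sum>\<^sub>\<infinity>k. a k * int_iterate (alpha \<sigma>) k (b (n - k)))"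

definition l1_star ::
    "('a::topological_space \<Rightarrow> 'a) \<Rightarrow> (int \<Rightarrow> 'a \<Rightarrow>\<^sub>C complex) \<Rightarrow> int \<Rightarrow> 'a \<Rightarrow>\<^sub>C complex" where
  "l1_star \<sigma> a n = cnj_bcontfun (int_iterate (alpha \<sigma>) n (a (- n)))"

lemma Metric_space_l1: "Metric_space l1 l1_dist"
proof
  have diff: "(\<lambda>k. norm (a k - b k)) summable_on UNIV" if "a \<in> l1" "b \<in> l1"
    for a b :: "int \<Rightarrow> 'a \<Rightarrow>\<^sub>C complex"
    by (rule summable_on_comparison_test[of "\<lambda>k. norm (a k) + norm (b k)"])
       (use that in \<open>auto simp: l1_def intro!: summable_on_add norm_triangle_ineq4\<close>)
  fix a b c :: "int \<Rightarrow> 'a \<Rightarrow>\<^sub>C complex"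
  show "0 \<le> l1_dist a b" by (simp add: l1_dist_def l1_norm_def infsum_nonneg)
  show "l1_dist a b = l1_dist b a" by (simp add: l1_dist_def l1_norm_def norm_minus_commute)
  assume a: "a \<in> l1" and b: "b \<in> l1"
  show "l1_dist a b = 0 \<longleftrightarrow> a = b"
  proof
    assume 0: "l1_dist a b = 0"
    have "norm (a k - b k) = 0" for k
      using nonneg_infsum_le_0D[OF _ diff[OF a b], of k] 0
      by (simp add: l1_dist_def l1_norm_def)
    then show "a = b" by auto
  qed (simp add: l1_dist_def l1_norm_def)
  assume c: "c \<in> l1"
  have "l1_dist a c \<le> (\<Sum>\<^sub>\<infinity>k. norm (a k - b k) + norm (b k - c k))"
    unfolding l1_dist_def l1_norm_def
    by (intro infsum_mono diff summable_on_add a b c norm_diff_triangle_ineq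
          order_trans[OF _ norm_triangle_ineq]) simp
  also have "\<dots> = l1_dist a b + l1_dist b c"
    unfolding l1_dist_def l1_norm_def by (intro infsum_add diff a b c)
  finally show "l1_dist a c \<le> l1_dist a b + l1_dist b c" .
qed

lemma norm_int_iterate_alpha_le:
  assumes "homeomorphism UNIV UNIV \<sigma> (inv \<sigma>)"
  shows "norm (int_iterate (alpha \<sigma>) k f) \<le> norm f"
  by (rule norm_bound) (simp add: apply_int_iterate_alpha[OF assms] norm_bounded)

lemma l1_mult_summable:
  assumes hom: "homeomorphism UNIV UNIV \<sigma> (inv \<sigma>)" and a: "a \<in> l1" and b: "b \<in> l1"
  shows "(\<lambda>k. norm (a k * int_iterate (alpha \<sigma>) k (b (n - k)))) summable_on UNIV"
    and "(\<lambda>k. a k * int_iterate (alpha \<sigma>) k (b (n - k))) summable_on UNIV"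
proof -
  have le: "norm (b m) \<le> l1_norm b" for m
    using finite_sum_le_infsum[of "\<lambda>k. norm (b k)" UNIV "{m}"] b
    by (simp add: l1_def l1_norm_def)
  show *: "(\<lambda>k. norm (a k * int_iterate (alpha \<sigma>) k (b (n - k)))) summable_on UNIV"
  proof (rule summable_on_comparison_test)
    show "(\<lambda>k. norm (a k) * l1_norm b) summable_on UNIV"
      using a by (auto simp: l1_def intro: summable_on_cmult_left)
    show "norm (a k * int_iterate (alpha \<sigma>) k (b (n - k))) \<le> norm (a k) * l1_norm b" for k
      by (rule order_trans[OF norm_mult_ineq])
         (auto intro!: mult_left_mono order_trans[OF norm_int_iterate_alpha_le[OF hom] le])
  qed auto
  show "(\<lambda>k. a k * int_iterate (alpha \<sigma>) k (b (n - k))) summable_on UNIV"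
    by (rule abs_summable_bcontfun(1)[OF *])
qed

section \<open>Ideals\<close>

definition l1_ideal ::
    "('a::topological_space \<Rightarrow> 'a) \<Rightarrow> (int \<Rightarrow> 'a \<Rightarrow>\<^sub>C complex) set \<Rightarrow> bool" where
  "l1_ideal \<sigma> I \<longleftrightarrow>
     I \<subseteq> l1 \<and> (\<lambda>n. 0) \<in> I \<and>
     (\<forall>a\<in>I. \<forall>b\<in>I. (\<lambda>n. a n + b n) \<in> I) \<and>
     (\<forall>c. \<forall>a\<in>I. (\<lambda>n. const_bcontfun c * a n) \<in> I) \<and>
     (\<forall>a\<in>I. \<forall>b\<in>l1. l1_mult \<sigma> b a \<in> I \<and> l1_mult \<sigma> a b \<in> I)"

definition closed_l1_ideal ::
    "('a::topological_space \<Rightarrow> 'a) \<Rightarrow> (int \<Rightarrow> 'a \<Rightarrow>\<^sub>C complex) set \<Rightarrow> bool" where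
  "closed_l1_ideal \<sigma> I \<longleftrightarrow>
     l1_ideal \<sigma> I \<and> closedin (Metric_space.mtopology l1 l1_dist) I"

definition self_adjoint ::
    "('a::topological_space \<Rightarrow> 'a) \<Rightarrow> (int \<Rightarrow> 'a \<Rightarrow>\<^sub>C complex) set \<Rightarrow> bool" where
  "self_adjoint \<sigma> I \<longleftrightarrow> (\<forall>a\<in>I. l1_star \<sigma> a \<in> I)"

end

theory Submission
  imports Defs
begin

text \<open>
  Suppose first that \<open>\<sigma>\<close> is free, and let \<open>a\<close> lie in a closed ideal \<open>I\<close>. For \<open>n \<noteq> 0\<close> every point
  \<open>y\<close> differs from \<open>\<sigma>\<^sup>-\<^sup>n y\<close>, so there is a unimodular function \<open>\<theta>\<close> with \<open>\<theta> = 1\<close> near \<open>y\<close> and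
  \<open>\<theta> = -1\<close> near \<open>\<sigma>\<^sup>-\<^sup>n y\<close>. The average of \<open>a\<close> and its conjugate by \<open>\<theta>\<close> lies in \<open>I\<close>, has the same
  zeroth coefficient as \<open>a\<close>, is nowhere larger than \<open>a\<close>, and its \<open>n\<close>-th coefficient vanishes near \<open>y\<close>.
  By compactness finitely many such averages remove the whole \<open>n\<close>-th coefficient
  (\<open>compress_kills_coefficient\<close>), and removing more and more coefficients shows that \<open>a(0)\<close> itself
  lies in \<open>I\<close> (\<open>zero_coefficient_mem\<close>). Shifting \<open>a\<close>, one gets all its coefficients. The functions
  in \<open>I\<close> are closed under conjugation (\<open>single_cnj_mem\<close>), so \<open>I\<close> contains all terms of \<open>a\<^sup>*\<close>, and
  hence \<open>a\<^sup>*\<close>.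

  Suppose now that \<open>\<sigma>\<^sup>d x = x\<close> with \<open>d \<ge> 1\<close>. For a bounded sequence \<open>T\<close>, the elements \<open>a\<close> with
  \<open>\<Sum>m. a(n - d m)(y) T(m) = 0\<close> for all \<open>n\<close> and all \<open>y\<close> in the orbit of \<open>x\<close> form a closed ideal.
  An element with constant coefficients \<open>g(m)\<close> in the degrees \<open>d m\<close> belongs to it exactly if the
  convolution \<open>g * T\<close> vanishes. So the problem is reduced to the group algebra of the integers: one
  needs \<open>g\<close> in \<open>\<ell>\<^sup>1(\<int>)\<close> and a bounded \<open>T\<close> with \<open>g * T = 0\<close> and \<open>g\<^sup>* * T \<noteq> 0\<close>
  (\<open>annihilator_not_self_adjoint_exists\<close>). This is a form of Malliavin's theorem on the failure of
  spectral synthesis, and it is obtained as follows.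

  Let \<open>v\<^sub>w\<close>, for Gaussian integers \<open>w\<close>, be unitaries of \<open>\<ell>\<^sup>1(\<int>)\<close> with \<open>v\<^sub>w v\<^sub>z = v\<^bsub>w+z\<^esub>\<close> whose
  coefficients decay so fast in \<open>w\<close>, uniformly over all coefficients, that \<open>T = \<Sum>w. w v\<^sub>w\<close>
  and \<open>S = \<Sum>w. v\<^sub>w\<close> converge as bounded sequences. Multiplication by \<open>v\<^sub>c\<close> shifts the summation
  index, so \<open>v\<^sub>c T = T - c S\<close>. Hence \<open>g = (v\<^sub>1 - 1) + i (v\<^sub>i - 1)\<close> satisfies \<open>g T = - S - i i S = 0\<close>
  and \<open>g\<^sup>* T = S - i i S = 2 S\<close>. If \<open>v\<^sub>w = exp (i Re (cnj w f))\<close>, then \<open>S\<close> and \<open>T\<close> are discrete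
  versions of a delta distribution composed with \<open>f\<close> and of a complex derivative of it. Replacing \<open>v\<^sub>w\<close> by
  \<open>v\<^bsub>L w\<^esub>\<close> with \<open>L\<close> large makes the term \<open>w = 0\<close> dominate, so that \<open>S \<noteq> 0\<close>.

  For the decay, take \<open>f\<close> lacunary, \<open>f = \<Sum>j. c\<^sub>j e\<^bsup>i \<lambda>\<^sub>j t\<^esup>\<close> with \<open>c\<^sub>j = 1/(j+1)\<^sup>2\<close> and rapidly
  growing \<open>\<lambda>\<^sub>j\<close>. A factor \<open>exp (i c\<^sub>j Re (cnj w e\<^bsup>i \<lambda>\<^sub>j t\<^esup>))\<close> with \<open>1/8 \<le> c\<^sub>j |w| \<le> 1/2\<close> has all its
  coefficients bounded by a constant \<open>q < 1\<close> (\<open>norm_coeff_exp_le\<close>). If \<open>\<lambda>\<^sub>j\<close> is large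
  compared with the bandwidth of the preceding factors, then the supremum of the coefficients is
  almost multiplicative (\<open>norm_coeff_mult_sparse_le\<close>). The number of indices \<open>j\<close> with
  \<open>1/8 \<le> c\<^sub>j |w| \<le> 1/2\<close> is of the order of the square root of \<open>|w|\<close>, which makes the
  coefficients of \<open>v\<^sub>w\<close> smaller than any negative power of \<open>|w|\<close> (\<open>superpolynomial_decay_exists\<close>).
\<close>

section \<open>The Wiener algebra\<close>

text \<open>
  Absolute summability is meant throughout in the sense of unordered sums, not of integrability with
  respect to a counting measure.
\<close>

no_notation Infinite_Set_Sum.abs_summable_on (infix \<open>abs'_summable'_on\<close> 50)

text \<open>
  The group algebra of the integers is made into a type in order to have the exponential function of
  Banach algebras available. Its elements are the Fourier coefficients of the functions on the circle
  with absolutely convergent Fourier series.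
\<close>

typedef wiener = "{a :: int \<Rightarrow> complex. a abs_summable_on UNIV}"
  morphisms coeff Wiener
  by (rule exI[of _ "\<lambda>_. 0"]) simp

setup_lifting type_definition_wiener

lemma coeff_abs_summable: "(\<lambda>n. cmod (coeff a n)) summable_on UNIV"
  using coeff[of a] by simp

lemma wiener_eqI: "(\<And>n. coeff a n = coeff b n) \<Longrightarrow> a = b"
  by (metis coeff_inject ext)

lemma abs_summable_finite_boundI:
  fixes f :: "'i \<Rightarrow> 'b::real_normed_vector"
  assumes "\<And>F. finite F \<Longrightarrow> (\<Sum>n\<in>F. norm (f n)) \<le> B"
  shows "f abs_summable_on UNIV" "(\<Sum>\<^sub>\<infinity>n. norm (f n)) \<le> B"
proof -
  show *: "f abs_summable_on UNIV"
    by (rule nonneg_bdd_above_summable_on) (auto intro!: bdd_aboveI2 assms)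
  show "(\<Sum>\<^sub>\<infinity>n. norm (f n)) \<le> B"
    by (rule infsum_le_finite_sums[OF *]) (auto intro: assms)
qed

lemma product_family_has_sum:
  fixes f :: "'i \<Rightarrow> real" and g :: "'j \<Rightarrow> real"
  assumes f: "f summable_on UNIV" "\<And>n. f n \<ge> 0" and g: "g summable_on UNIV" "\<And>n. g n \<ge> 0"
  shows "((\<lambda>(k, m). f k * g m) has_sum (infsum f UNIV * infsum g UNIV)) UNIV"
proof -
  have 1: "((\<lambda>m. f k * g m) has_sum (f k * infsum g UNIV)) UNIV" for k
    by (intro has_sum_cmult_right has_sum_infsum g)
  have "(\<lambda>(k, m). f k * g m) summable_on UNIV \<times> UNIV"
    by (rule summable_on_SigmaI[where g = "\<lambda>k. f k * infsum g UNIV"])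
       (use 1 f g in \<open>auto intro: summable_on_cmult_left\<close>)
  then have "((\<lambda>(k, m). f k * g m) has_sum (infsum f UNIV * infsum g UNIV)) (UNIV \<times> UNIV)"
    by (intro has_sum_SigmaI[where g = "\<lambda>k. f k * infsum g UNIV"])
       (use 1 f in \<open>auto intro!: has_sum_cmult_left\<close>)
  then show ?thesis by simp
qed

lemma convolution_family_has_sum:
  fixes f g :: "int \<Rightarrow> real"
  assumes f: "f summable_on UNIV" "\<And>n. f n \<ge> 0" and g: "g summable_on UNIV" "\<And>n. g n \<ge> 0"
  shows "((\<lambda>(n, k). f k * g (n - k)) has_sum (infsum f UNIV * infsum g UNIV)) UNIV"
proof -
  have "bij_betw (\<lambda>(n, k). (k, n - k)) (UNIV :: (int \<times> int) set) UNIV"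
    by (rule bij_betw_byWitness[where f' = "\<lambda>(k, m). (k + m, k)"]) auto
  from has_sum_reindex_bij_betw[OF this, of "\<lambda>(k, m). f k * g m"]
    product_family_has_sum[OF assms] show ?thesis
    by (simp add: case_prod_unfold)
qed

lemma convolution_family_abs_summable:
  assumes "a abs_summable_on UNIV" "b abs_summable_on (UNIV :: int set)"
  shows "(\<lambda>(n, k). a k * b (n - k) :: complex) abs_summable_on UNIV"
  using has_sum_imp_summable[OF convolution_family_has_sum[of "\<lambda>n. cmod (a n)" "\<lambda>n. cmod (b n)"]] assms
  by (simp add: case_prod_unfold norm_mult)

lemma abs_summable_slices:
  assumes "(\<lambda>(n, k). f n k) abs_summable_on UNIV"
  shows "(\<lambda>k. f n k) abs_summable_on UNIV"
    and "(\<lambda>n. \<Sum>\<^sub>\<infinity>k. norm (f n k)) summable_on UNIV"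
proof -
  have *: "(\<lambda>(n, k). f n k) abs_summable_on UNIV \<times> UNIV" using assms by simp
  show "(\<lambda>k. f n k) abs_summable_on UNIV"
    "(\<lambda>n. \<Sum>\<^sub>\<infinity>k. norm (f n k)) summable_on UNIV"
    using *[unfolded Infinite_Sum.abs_summable_on_Sigma_iff] by (auto simp: infsum_nonneg)
qed

lemma abs_summable_plus:
  fixes f g :: "'i \<Rightarrow> 'b::real_normed_vector"
  assumes "f abs_summable_on A" "g abs_summable_on A"
  shows "(\<lambda>n. f n + g n) abs_summable_on A"
  by (rule summable_on_comparison_test[OF summable_on_add[OF assms]]) (auto intro: norm_triangle_ineq)

lemma abs_summable_minus:
  fixes f g :: "'i \<Rightarrow> 'b::real_normed_vector"
  assumes "f abs_summable_on A" "g abs_summable_on A"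
  shows "(\<lambda>n. f n - g n) abs_summable_on A"
  by (rule summable_on_comparison_test[OF summable_on_add[OF assms]]) (auto intro: norm_triangle_ineq4)

instantiation wiener :: real_normed_vector
begin

lift_definition zero_wiener :: wiener is "\<lambda>_. 0" by simp

lift_definition plus_wiener :: "wiener \<Rightarrow> wiener \<Rightarrow> wiener" is "\<lambda>a b n. a n + b n"
  by (rule abs_summable_plus)

lift_definition uminus_wiener :: "wiener \<Rightarrow> wiener" is "\<lambda>a n. - a n" by simp

lift_definition minus_wiener :: "wiener \<Rightarrow> wiener \<Rightarrow> wiener" is "\<lambda>a b n. a n - b n"
  by (rule abs_summable_minus)

lift_definition scaleR_wiener :: "real \<Rightarrow> wiener \<Rightarrow> wiener" is "\<lambda>r a n. r *\<^sub>R a n"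
  by (auto intro: summable_on_cmult_right)

lift_definition norm_wiener :: "wiener \<Rightarrow> real" is "\<lambda>a. \<Sum>\<^sub>\<infinity>n. cmod (a n)" .

definition sgn_wiener :: "wiener \<Rightarrow> wiener" where "sgn_wiener a = inverse (norm a) *\<^sub>R a"
definition dist_wiener :: "wiener \<Rightarrow> wiener \<Rightarrow> real" where "dist_wiener a b = norm (a - b)"
definition uniformity_wiener :: "(wiener \<times> wiener) filter" where
  "uniformity_wiener = (INF e\<in>{0 <..}. principal {(x, y). dist x y < e})"
definition open_wiener :: "wiener set \<Rightarrow> bool" where
  "open_wiener U \<longleftrightarrow> (\<forall>x\<in>U. eventually (\<lambda>(x', y). x' = x \<longrightarrow> y \<in> U) uniformity)"

instance
proof
  fix a b c :: wiener and r s :: real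
  show "norm a = 0 \<longleftrightarrow> a = 0"
  proof
    assume "norm a = 0"
    then have "cmod (coeff a n) = 0" for n
      using nonneg_infsum_le_0D[OF _ coeff_abs_summable[of a], of n]
      by (simp add: norm_wiener.rep_eq)
    then show "a = 0" by (intro wiener_eqI) (simp add: zero_wiener.rep_eq)
  qed (simp add: norm_wiener.rep_eq zero_wiener.rep_eq)
  have "norm (a + b) \<le> (\<Sum>\<^sub>\<infinity>n. cmod (coeff a n) + cmod (coeff b n))"
    unfolding norm_wiener.rep_eq plus_wiener.rep_eq
    using coeff_abs_summable[of "a + b"]
    by (intro infsum_mono summable_on_add coeff_abs_summable norm_triangle_ineq)
       (simp add: plus_wiener.rep_eq)
  also have "\<dots> = norm a + norm b"
    unfolding norm_wiener.rep_eq by (intro infsum_add coeff_abs_summable)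
  finally show "norm (a + b) \<le> norm a + norm b" .
  show "norm (r *\<^sub>R a) = \<bar>r\<bar> * norm a"
    by (simp add: norm_wiener.rep_eq scaleR_wiener.rep_eq infsum_cmult_right')
qed (simp_all add: sgn_wiener_def dist_wiener_def uniformity_wiener_def open_wiener_def,
     (transfer; simp add: fun_eq_iff algebra_simps)+)

end

lemma coeff_simps [simp]:
  "coeff 0 n = 0" "coeff (a + b) n = coeff a n + coeff b n"
  "coeff (a - b) n = coeff a n - coeff b n" "coeff (- a) n = - coeff a n"
  "coeff (r *\<^sub>R a) n = of_real r * coeff a n"
  by (simp_all add: zero_wiener.rep_eq plus_wiener.rep_eq minus_wiener.rep_eq
      uminus_wiener.rep_eq scaleR_wiener.rep_eq scaleR_conv_of_real)

lemma norm_coeff_le: "cmod (coeff a n) \<le> norm a"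
  using finite_sum_le_infsum[OF coeff_abs_summable, of "{n}" a] by (simp add: norm_wiener.rep_eq)

lemma sum_norm_coeff_le: "finite F \<Longrightarrow> (\<Sum>n\<in>F. cmod (coeff a n)) \<le> norm a"
  using finite_sum_le_infsum[OF coeff_abs_summable, of F a] by (simp add: norm_wiener.rep_eq)

lemma coeff_bounded_linear: "bounded_linear (\<lambda>a. coeff a n)"
  by (rule bounded_linear_intro[of _ 1]) (auto simp: norm_coeff_le scaleR_conv_of_real)

instance wiener :: banach
proof
  fix X :: "nat \<Rightarrow> wiener"
  assume X: "Cauchy X"
  have "\<exists>l. (\<lambda>i. coeff (X i) n) \<longlonglongrightarrow> l" for n
    using bounded_linear.Cauchy[OF coeff_bounded_linear X]
    by (simp add: Cauchy_convergent_iff convergent_def)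
  then obtain l where l: "\<And>n. (\<lambda>i. coeff (X i) n) \<longlonglongrightarrow> l n" by metis
  have bound: "\<exists>M. \<forall>i\<ge>M. \<forall>F. finite F \<longrightarrow> (\<Sum>n\<in>F. cmod (coeff (X i) n - l n)) \<le> e"
    if "e > 0" for e
  proof -
    obtain M where M: "\<And>i j. i \<ge> M \<Longrightarrow> j \<ge> M \<Longrightarrow> norm (X i - X j) < e"
      using metric_CauchyD[OF X \<open>e > 0\<close>] by (auto simp: dist_norm)
    have "(\<Sum>n\<in>F. cmod (coeff (X i) n - l n)) \<le> e" if "i \<ge> M" "finite F" for i F
    proof (rule LIMSEQ_le_const2)
      show "(\<lambda>j. \<Sum>n\<in>F. cmod (coeff (X i) n - coeff (X j) n))
              \<longlonglongrightarrow> (\<Sum>n\<in>F. cmod (coeff (X i) n - l n))"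
        by (intro tendsto_intros l)
      show "\<exists>N. \<forall>j\<ge>N. (\<Sum>n\<in>F. cmod (coeff (X i) n - coeff (X j) n)) \<le> e"
      proof (intro exI[of _ M] allI impI)
        fix j assume "j \<ge> M"
        then show "(\<Sum>n\<in>F. cmod (coeff (X i) n - coeff (X j) n)) \<le> e"
          using sum_norm_coeff_le[OF \<open>finite F\<close>, of "X i - X j"] M[OF \<open>i \<ge> M\<close>, of j] by simp
      qed
    qed
    then show ?thesis by blast
  qed
  obtain M where "\<forall>F. finite F \<longrightarrow> (\<Sum>n\<in>F. cmod (coeff (X M) n - l n)) \<le> 1"
    using bound[of 1] by auto
  then have "(\<lambda>n. coeff (X M) n - l n) abs_summable_on UNIV"
    by (intro abs_summable_finite_boundI) auto
  then have "(\<lambda>n. cmod (coeff (X M) n) + cmod (coeff (X M) n - l n)) summable_on UNIV"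
    by (intro summable_on_add coeff_abs_summable) simp
  then have "l abs_summable_on UNIV"
    by (rule summable_on_comparison_test) (auto intro: norm_triangle_sub norm_minus_commute
      simp: norm_minus_commute)
  then have L: "coeff (Wiener l) = l" by (simp add: Wiener_inverse)
  have "X \<longlonglongrightarrow> Wiener l"
  proof (rule LIMSEQ_I)
    fix e :: real assume "e > 0"
    obtain M where M: "\<forall>i\<ge>M. \<forall>F. finite F \<longrightarrow> (\<Sum>n\<in>F. cmod (coeff (X i) n - l n)) \<le> e / 2"
      using bound[of "e / 2"] \<open>e > 0\<close> by auto
    have "norm (X i - Wiener l) \<le> e / 2" if "i \<ge> M" for i
      using abs_summable_finite_boundI(2)[of "\<lambda>n. coeff (X i) n - l n" "e / 2"] M that
      by (simp add: norm_wiener.rep_eq minus_wiener.rep_eq L)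
    then show "\<exists>M. \<forall>i\<ge>M. norm (X i - Wiener l) < e" using \<open>e > 0\<close> by (intro exI[of _ M]) force
  qed
  then show "convergent X" by (auto simp: convergent_def)
qed

lift_definition single :: "int \<Rightarrow> complex \<Rightarrow> wiener" is "\<lambda>m z n. if n = m then z else 0"
proof -
  fix m :: int and z :: complex
  show "(\<lambda>n. if n = m then z else 0) abs_summable_on UNIV"
    by (rule finite_nonzero_values_imp_summable_on, rule finite_subset[of _ "{m}"]) auto
qed

lemma coeff_single: "coeff (single m z) n = (if n = m then z else 0)"
  by (simp add: single.rep_eq)

lemma infsum_single_support:
  fixes f :: "'i \<Rightarrow> 'b::{comm_monoid_add, t2_space}"
  assumes "\<And>k. k \<noteq> m \<Longrightarrow> f k = 0"
  shows "(\<Sum>\<^sub>\<infinity>k. f k) = f m"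
  by (rule infsumI, rule has_sum_finite_neutralI[of "{m}"]) (use assms in auto)

instantiation wiener :: real_normed_algebra_1
begin

lift_definition times_wiener :: "wiener \<Rightarrow> wiener \<Rightarrow> wiener"
  is "\<lambda>a b n. \<Sum>\<^sub>\<infinity>k. a k * b (n - k)"
proof -
  fix a b :: "int \<Rightarrow> complex"
  assume "a abs_summable_on UNIV" "b abs_summable_on UNIV"
  note slices = abs_summable_slices[OF convolution_family_abs_summable[OF this]]
  show "(\<lambda>n. \<Sum>\<^sub>\<infinity>k. a k * b (n - k)) abs_summable_on UNIV"
    by (rule summable_on_comparison_test[OF slices(2) norm_infsum_bound[OF slices(1)]]) simp
qed

definition one_wiener :: wiener where "one_wiener = single 0 1"

lemma mult_summable:
  "(\<lambda>(n, k). coeff a k * coeff b (n - k)) abs_summable_on UNIV"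
  "(\<lambda>k. coeff a k * coeff b (n - k)) abs_summable_on UNIV"
  "(\<lambda>k. coeff a k * coeff b (n - k)) summable_on UNIV"
proof -
  show *: "(\<lambda>(n, k). coeff a k * coeff b (n - k)) abs_summable_on UNIV"
    by (intro convolution_family_abs_summable coeff_abs_summable)
  show "(\<lambda>k. coeff a k * coeff b (n - k)) abs_summable_on UNIV"
    by (rule abs_summable_slices[OF *])
  then show "(\<lambda>k. coeff a k * coeff b (n - k)) summable_on UNIV"
    by (rule Infinite_Sum.abs_summable_summable)
qed

instance
proof
  fix a b c :: wiener and r :: real
  show "a * b * c = a * (b * c)"
  proof (rule wiener_eqI)
    fix n
    have "(\<lambda>(j, k). norm (coeff a k * coeff b (j - k)) * norm c) summable_on UNIV \<times> UNIV"
      using summable_on_cmult_left[OF mult_summable(1)[of a b], of "norm c"]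
      by (simp add: case_prod_unfold)
    then have "(\<lambda>(j, k). coeff a k * coeff b (j - k) * coeff c (n - j)) abs_summable_on UNIV \<times> UNIV"
    proof (rule summable_on_comparison_test)
      fix x :: "int \<times> int"
      show "norm (case x of (j, k) \<Rightarrow> coeff a k * coeff b (j - k) * coeff c (n - j))
          \<le> (case x of (j, k) \<Rightarrow> norm (coeff a k * coeff b (j - k)) * norm c)"
        by (cases x) (simp add: norm_mult mult_left_mono norm_coeff_le)
    qed simp
    then have swap: "(\<lambda>(j, k). coeff a k * coeff b (j - k) * coeff c (n - j)) summable_on UNIV \<times> UNIV"
      by (rule abs_summable_summable)
    have "coeff (a * b * c) n = (\<Sum>\<^sub>\<infinity>j. \<Sum>\<^sub>\<infinity>k. coeff a k * coeff b (j - k) * coeff c (n - j))"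
      by (simp add: times_wiener.rep_eq infsum_cmult_left')
    also have "\<dots> = (\<Sum>\<^sub>\<infinity>k. \<Sum>\<^sub>\<infinity>j. coeff a k * coeff b (j - k) * coeff c (n - j))"
      by (rule infsum_swap_banach[OF swap])
    also have "\<dots> = (\<Sum>\<^sub>\<infinity>k. coeff a k * (\<Sum>\<^sub>\<infinity>j. coeff b (j - k) * coeff c (n - j)))"
      by (simp add: mult.assoc infsum_cmult_right')
    also have "(\<lambda>k. \<Sum>\<^sub>\<infinity>j. coeff b (j - k) * coeff c (n - j)) = (\<lambda>k. coeff (b * c) (n - k))"
    proof
      fix k
      have "bij_betw (\<lambda>l. l + k) (UNIV :: int set) UNIV"
        by (rule bij_betw_byWitness[where f' = "\<lambda>j. j - k"]) auto
      from infsum_reindex_bij_betw[OF this, of "\<lambda>j. coeff b (j - k) * coeff c (n - j)"]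
      show "(\<Sum>\<^sub>\<infinity>j. coeff b (j - k) * coeff c (n - j)) = coeff (b * c) (n - k)"
        by (simp add: times_wiener.rep_eq algebra_simps)
    qed
    finally show "coeff (a * b * c) n = coeff (a * (b * c)) n"
      by (simp add: times_wiener.rep_eq)
  qed
  have comm: "a * b = b * a" for a b :: wiener
  proof (rule wiener_eqI)
    fix n
    have "bij_betw (\<lambda>k. n - k) (UNIV :: int set) UNIV"
      by (rule bij_betw_byWitness[where f' = "\<lambda>k. n - k"]) auto
    from infsum_reindex_bij_betw[OF this, of "\<lambda>k. coeff a k * coeff b (n - k)"]
    show "coeff (a * b) n = coeff (b * a) n"
      by (simp add: times_wiener.rep_eq mult.commute)
  qed
  have one: "1 * a = a" for a :: wiener
  proof (rule wiener_eqI)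
    fix n show "coeff (1 * a) n = coeff a n"
      using infsum_single_support[of 0 "\<lambda>k. coeff 1 k * coeff a (n - k)"]
      by (simp add: times_wiener.rep_eq one_wiener_def coeff_single)
  qed
  show "1 * a = a" by (rule one)
  show "a * 1 = a" unfolding comm[of a] by (rule one)
  have distr: "(a + b) * c = a * c + b * c" for a b c :: wiener
  proof (rule wiener_eqI)
    fix n show "coeff ((a + b) * c) n = coeff (a * c + b * c) n"
      by (simp add: times_wiener.rep_eq distrib_right infsum_add mult_summable)
  qed
  show "(a + b) * c = a * c + b * c" by (rule distr)
  show "a * (b + c) = a * b + a * c" unfolding comm[of a] by (rule distr)
  have sc: "(r *\<^sub>R a) * b = r *\<^sub>R (a * b)" for a b :: wiener
  proof (rule wiener_eqI)
    fix n show "coeff (r *\<^sub>R a * b) n = coeff (r *\<^sub>R (a * b)) n"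
      by (simp add: times_wiener.rep_eq mult.assoc infsum_cmult_right')
  qed
  show "(r *\<^sub>R a) * b = r *\<^sub>R (a * b)" by (rule sc)
  show "a * (r *\<^sub>R b) = r *\<^sub>R (a * b)" unfolding comm[of a] by (rule sc)
  have "coeff 0 0 \<noteq> coeff (1::wiener) 0" by (simp add: one_wiener_def coeff_single)
  then show "(0::wiener) \<noteq> 1" by metis
  show "norm (1::wiener) = 1"
    using infsum_single_support[of 0 "\<lambda>n. cmod (coeff 1 n)"]
    by (simp add: norm_wiener.rep_eq one_wiener_def coeff_single)
  show "norm (a * b) \<le> norm a * norm b"
  proof -
    let ?h = "\<lambda>n. \<Sum>\<^sub>\<infinity>k. cmod (coeff a k * coeff b (n - k))"
    have "norm (a * b) \<le> (\<Sum>\<^sub>\<infinity>n. ?h n)"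
      unfolding norm_wiener.rep_eq
    proof (rule infsum_mono[OF coeff_abs_summable])
      show "?h summable_on UNIV"
        by (rule abs_summable_slices(2)[OF mult_summable(1)])
      show "cmod (coeff (a * b) n) \<le> ?h n" for n
        unfolding times_wiener.rep_eq by (rule norm_infsum_bound[OF mult_summable(2)])
    qed
    also have "\<dots> = (\<Sum>\<^sub>\<infinity>(n, k)\<in>UNIV \<times> UNIV. cmod (coeff a k * coeff b (n - k)))"
      using mult_summable(1)[of a b]
      by (intro infsum_Sigma'_banach) (simp add: case_prod_unfold)
    also have "\<dots> = norm a * norm b"
      unfolding norm_wiener.rep_eq UNIV_Times_UNIV norm_mult
      by (intro infsumI convolution_family_has_sum coeff_abs_summable norm_ge_zero)
    finally show ?thesis .
  qed
qed

end

lemma wiener_mult_commute: "a * b = b * (a :: wiener)"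
proof (rule wiener_eqI)
  fix n
  have "bij_betw (\<lambda>k. n - k) (UNIV :: int set) UNIV"
    by (rule bij_betw_byWitness[where f' = "\<lambda>k. n - k"]) auto
  from infsum_reindex_bij_betw[OF this, of "\<lambda>k. coeff a k * coeff b (n - k)"]
  show "coeff (a * b) n = coeff (b * a) n"
    by (simp add: times_wiener.rep_eq mult.commute)
qed

instance wiener :: comm_ring_1
proof
  fix a b c :: wiener
  show "a * b = b * a" by (rule wiener_mult_commute)
  show "1 * a = a" by (rule mult_1_left)
  show "(a + b) * c = a * c + b * c" by (rule distrib_right)
qed

section \<open>Supremum bounds on coefficients\<close>

lemma norm_single [simp]: "norm (single m z) = cmod z"
  using infsum_single_support[of m "\<lambda>n. cmod (coeff (single m z) n)"]
  by (simp add: norm_wiener.rep_eq coeff_single)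

lemma coeff_single_mult: "coeff (single m z * a) n = z * coeff a (n - m)"
  using infsum_single_support[of m "\<lambda>k. coeff (single m z) k * coeff a (n - k)"]
  by (simp add: times_wiener.rep_eq coeff_single)

lemma single_mult: "single m z * single n w = single (m + n) (z * w)"
  by (rule wiener_eqI) (auto simp: coeff_single_mult coeff_single)

lemma single_add: "single m z + single m w = single m (z + w)"
  by (rule wiener_eqI) (auto simp: coeff_single)

lemma coeff_one: "coeff 1 n = (if n = 0 then 1 else 0)"
  by (simp add: one_wiener_def coeff_single)

lift_definition star :: "wiener \<Rightarrow> wiener" is "\<lambda>a n. cnj (a (- n))"
proof -
  fix a :: "int \<Rightarrow> complex"
  assume "a abs_summable_on UNIV"
  moreover have "bij_betw (\<lambda>n. - n) (UNIV :: int set) UNIV"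
    by (rule bij_betw_byWitness[where f' = "\<lambda>n. - n"]) auto
  ultimately show "(\<lambda>n. cnj (a (- n))) abs_summable_on UNIV"
    using summable_on_reindex_bij_betw[of "\<lambda>n. - n" UNIV UNIV "\<lambda>n. cmod (a n)"] by simp
qed

lemma coeff_star [simp]: "coeff (star a) n = cnj (coeff a (- n))"
  by (simp add: star.rep_eq)

lemma norm_star [simp]: "norm (star a) = norm a"
proof -
  have "bij_betw (\<lambda>n. - n) (UNIV :: int set) UNIV"
    by (rule bij_betw_byWitness[where f' = "\<lambda>n. - n"]) auto
  from infsum_reindex_bij_betw[OF this, of "\<lambda>n. cmod (coeff a n)"] show ?thesis
    by (simp add: norm_wiener.rep_eq)
qed

lemma star_add: "star (a + b) = star a + star b"
  and star_diff: "star (a - b) = star a - star b"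
  and star_scaleR: "star (r *\<^sub>R a) = r *\<^sub>R star a"
  and star_single: "star (single m z) = single (- m) (cnj z)"
  by (auto intro!: wiener_eqI simp: coeff_single)

lemma star_one [simp]: "star 1 = 1"
  by (simp add: one_wiener_def star_single)

lemma star_mult: "star (a * b) = star a * star b"
proof (rule wiener_eqI)
  fix n
  have "bij_betw (\<lambda>k. - k) (UNIV :: int set) UNIV"
    by (rule bij_betw_byWitness[where f' = "\<lambda>k. - k"]) auto
  from infsum_reindex_bij_betw[OF this, of "\<lambda>k. cnj (coeff a k) * cnj (coeff b (- n - k))"]
  show "coeff (star (a * b)) n = coeff (star a * star b) n"
    by (simp add: times_wiener.rep_eq algebra_simps flip: infsum_cnj)
qed

lemma star_power: "star (a ^ k) = star a ^ k"
  by (induction k) (simp_all add: star_mult)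

lemma star_exp: "star (exp a) = exp (star a)"
proof -
  have "bounded_linear star"
    by (rule bounded_linear_intro[of _ 1]) (auto simp: star_add star_scaleR)
  from bounded_linear.sums[OF this exp_converges[of a]]
  have "(\<lambda>k. star a ^ k /\<^sub>R fact k) sums star (exp a)"
    by (simp add: star_scaleR star_power)
  then show ?thesis using exp_converges[of "star a"] sums_unique2 by blast
qed

text \<open>
  Parseval: the squared moduli of the coefficients sum to the zeroth coefficient of \<open>a a\<^sup>*\<close>.
\<close>

lemma norm_coeff_unitary_le_1:
  assumes "a * star a = 1"
  shows "cmod (coeff a n) \<le> 1"
proof -
  have sum: "(\<lambda>k. coeff a k * cnj (coeff a k)) summable_on UNIV"
    using mult_summable(3)[of a "star a" 0] by simp
  have Re: "Re (coeff a k * cnj (coeff a k)) = (cmod (coeff a k))\<^sup>2" for k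
    by (simp only: complex_norm_square[symmetric] Re_complex_of_real)
  have "(\<Sum>\<^sub>\<infinity>k. coeff a k * cnj (coeff a k)) = coeff (a * star a) 0"
    by (simp add: times_wiener.rep_eq)
  also have "\<dots> = 1" by (simp add: assms coeff_one)
  finally have "(\<Sum>\<^sub>\<infinity>k. (cmod (coeff a k))\<^sup>2) = 1"
    using infsum_Re[OF sum] by (simp only: Re one_complex.sel)
  moreover have "(\<lambda>k. (cmod (coeff a k))\<^sup>2) summable_on UNIV"
    using summable_on_Re[OF sum] by (simp only: Re)
  ultimately have "(cmod (coeff a n))\<^sup>2 \<le> 1"
    using finite_sum_le_infsum[of "\<lambda>k. (cmod (coeff a k))\<^sup>2" UNIV "{n}"] by simp
  then show ?thesis by (simp add: power_le_one_iff abs_square_le_1)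
qed

definition supp_multiples :: "int \<Rightarrow> wiener \<Rightarrow> bool" where
  "supp_multiples l a \<longleftrightarrow> (\<forall>n. \<not> l dvd n \<longrightarrow> coeff a n = 0)"

lemma supp_multiples_mult:
  assumes "supp_multiples l a" "supp_multiples l b"
  shows "supp_multiples l (a * b)"
  unfolding supp_multiples_def
proof (intro allI impI)
  fix n assume n: "\<not> l dvd n"
  have "coeff a k * coeff b (n - k) = 0" for k
  proof (cases "l dvd k")
    case True
    then have "\<not> l dvd n - k" using n by (metis diff_add_cancel dvd_add)
    then show ?thesis using assms by (simp add: supp_multiples_def)
  qed (use assms in \<open>simp add: supp_multiples_def\<close>)
  then show "coeff (a * b) n = 0" unfolding times_wiener.rep_eq by (simp only: infsum_0_simp)
qed

text \<open>
  The elements supported on the multiples of \<open>l\<close> form a closed subalgebra.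
\<close>

lemma supp_multiples_exp:
  assumes "supp_multiples l a"
  shows "supp_multiples l (exp a)"
  unfolding supp_multiples_def
proof (intro allI impI)
  fix n assume n: "\<not> l dvd n"
  have "supp_multiples l (a ^ k)" for k
    by (induction k) (auto simp: supp_multiples_mult assms, auto simp: supp_multiples_def coeff_one)
  then have "coeff (a ^ k /\<^sub>R fact k) n = 0" for k using n by (simp add: supp_multiples_def)
  then have "(\<lambda>k. 0) sums coeff (exp a) n"
    using bounded_linear.sums[OF coeff_bounded_linear exp_converges[of a], of n] by simp
  then show "coeff (exp a) n = 0" using sums_0 sums_unique2 by blast
qed

text \<open>
  Stated with finite sums, the bound is immediately monotone in \<open>N\<close>, and it can be used below
  together with estimates of finite partial sums.
\<close>

definition tail_le :: "wiener \<Rightarrow> int \<Rightarrow> real \<Rightarrow> bool" where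
  "tail_le a N e \<longleftrightarrow>
    (\<forall>F. finite F \<longrightarrow> (\<forall>i\<in>F. N < \<bar>i\<bar>) \<longrightarrow> (\<Sum>i\<in>F. cmod (coeff a i)) \<le> e)"

lemma tail_le_mono: "tail_le a N e \<Longrightarrow> N \<le> M \<Longrightarrow> tail_le a M e"
  unfolding tail_le_def by (meson order.strict_trans1)

lemma ex_tail_le:
  assumes "e > 0"
  shows "\<exists>N. tail_le a N e"
proof -
  obtain F where F: "finite F" "\<bar>(\<Sum>i\<in>F. cmod (coeff a i)) - norm a\<bar> \<le> e"
    using infsum_finite_approximation[OF coeff_abs_summable assms, of a]
    by (auto simp: norm_wiener.rep_eq dist_real_def)
  have "(\<Sum>i\<in>G. cmod (coeff a i)) \<le> e" if G: "finite G" "\<forall>i\<in>G. Max (insert 0 (abs ` F)) < \<bar>i\<bar>" for G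
  proof -
    have "F \<inter> G = {}" using F(1) G(2) by fastforce
    then have "(\<Sum>i\<in>F. cmod (coeff a i)) + (\<Sum>i\<in>G. cmod (coeff a i)) \<le> norm a"
      using sum_norm_coeff_le[of "F \<union> G" a] F(1) G(1) by (simp add: sum.union_disjoint)
    then show ?thesis using F(2) by linarith
  qed
  then show ?thesis unfolding tail_le_def by blast
qed

lemma ex_tail_le_finite:
  assumes "e > 0" "finite W"
  shows "\<exists>N\<ge>0. \<forall>a\<in>W. tail_le a N e"
  using assms(2)
proof (induction W)
  case (insert b W)
  then obtain N where N: "N \<ge> 0" "\<forall>a\<in>W. tail_le a N e" by blast
  obtain M where M: "tail_le b M e" using ex_tail_le[OF assms(1)] by blast
  show ?case
    by (rule exI[of _ "max N M"]) (use N M in \<open>auto intro: tail_le_mono\<close>)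
qed auto

text \<open>
  If \<open>a\<close> lived in \<open>[-N, N]\<close>, then at most one term of the convolution sum at \<open>n\<close> would be non-zero,
  because two indices in the same class modulo \<open>l > 2 N\<close> cannot both lie in that interval. The
  supremum of the coefficients of \<open>a b\<close> would then be at most the product of the two suprema; the
  part of \<open>a\<close> outside the interval contributes the error \<open>B e\<close>.
\<close>

lemma norm_coeff_mult_sparse_le:
  assumes tail: "tail_le a N e" and l: "2 * N < l"
    and a: "\<And>n. cmod (coeff a n) \<le> A"
    and supp: "supp_multiples l b" and b: "\<And>n. cmod (coeff b n) \<le> B"
  shows "cmod (coeff (a * b) n) \<le> B * (A + e)"
proof -
  have B: "B \<ge> 0" and A: "A \<ge> 0" using a b order_trans[OF norm_ge_zero] by blast+
  have "(\<Sum>\<^sub>\<infinity>k. cmod (coeff a k * coeff b (n - k))) \<le> B * (A + e)"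
  proof (rule abs_summable_finite_boundI(2))
    fix F :: "int set" assume F: "finite F"
    let ?P = "\<lambda>k. l dvd n - k"
    let ?G = "{k \<in> F. ?P k \<and> \<bar>k\<bar> \<le> N}" and ?H = "{k \<in> F. ?P k \<and> N < \<bar>k\<bar>}"
    have G: "(\<Sum>k\<in>?G. cmod (coeff a k)) \<le> A"
    proof (cases "?G = {}")
      case True
      then show ?thesis using A by (simp only: sum.empty)
    next
      case False
      then obtain k where k: "k \<in> ?G" by blast
      have "j = k" if "j \<in> ?G" for j
      proof -
        have "l dvd j - k" using that k by (auto dest: dvd_diff[of l "n - k" "n - j"])
        moreover have "\<bar>j - k\<bar> < l" using that k l by auto
        ultimately show ?thesis using dvd_imp_le_int[of "j - k" l] by linarith
      qed
      then have "?G = {k}" using k by blast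
      then show ?thesis using a by simp
    qed
    have H: "(\<Sum>k\<in>?H. cmod (coeff a k)) \<le> e"
      using tail F by (simp add: tail_le_def)
    have "(\<Sum>k\<in>F. cmod (coeff a k * coeff b (n - k))) \<le> (\<Sum>k\<in>F. if ?P k then B * cmod (coeff a k) else 0)"
    proof (rule sum_mono)
      fix k
      show "cmod (coeff a k * coeff b (n - k)) \<le> (if ?P k then B * cmod (coeff a k) else 0)"
        using supp b[of "n - k"]
        by (auto simp: supp_multiples_def norm_mult mult.commute[of B] mult_left_mono)
    qed
    also have "\<dots> = (\<Sum>k\<in>?G \<union> ?H. B * cmod (coeff a k))"
      by (rule sum.mono_neutral_cong_right) (use F in auto)
    also have "\<dots> = B * ((\<Sum>k\<in>?G. cmod (coeff a k)) + (\<Sum>k\<in>?H. cmod (coeff a k)))"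
      using F by (subst sum.union_disjoint) (auto simp: distrib_left sum_distrib_left)
    also have "\<dots> \<le> B * (A + e)" using G H B by (intro mult_left_mono add_mono)
    finally show "(\<Sum>k\<in>F. cmod (coeff a k * coeff b (n - k))) \<le> B * (A + e)" .
  qed
  then show ?thesis
    unfolding times_wiener.rep_eq by (rule order_trans[OF norm_infsum_bound[OF mult_summable(2)]])
qed

lemma norm_coeff_mult_le:
  assumes "\<And>n. cmod (coeff a n) \<le> A"
  shows "cmod (coeff (a * b) n) \<le> A * norm b"
proof -
  have "cmod (coeff (b * a) n) \<le> (\<Sum>\<^sub>\<infinity>k. cmod (coeff b k * coeff a (n - k)))"
    unfolding times_wiener.rep_eq by (rule norm_infsum_bound[OF mult_summable(2)])
  also have "\<dots> \<le> (\<Sum>\<^sub>\<infinity>k. A * cmod (coeff b k))"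
    by (intro infsum_mono mult_summable summable_on_cmult_right coeff_abs_summable)
       (auto simp: norm_mult mult.commute[of A] intro: mult_left_mono assms)
  also have "\<dots> = A * norm b" by (simp add: infsum_cmult_right' norm_wiener.rep_eq)
  finally show ?thesis by (simp add: mult.commute)
qed

lemma norm_exp_remainder3_le:
  fixes y :: "'b::{real_normed_algebra_1,banach}"
  assumes "norm y \<le> 1 / 2"
  shows "norm (exp y - (1 + y + (1 / 2) *\<^sub>R (y * y))) \<le> norm y ^ 3 / 3"
proof -
  have eq: "exp y - (1 + y + (1 / 2) *\<^sub>R (y * y)) = (\<Sum>n. inverse (fact (n + 3)) *\<^sub>R (y ^ (n + 3)))"
    using exp_first_terms[of y 3]
    by (simp add: eval_nat_numeral inverse_eq_divide)
  have "norm (inverse (fact (n + 3)) *\<^sub>R (y ^ (n + 3))) \<le> norm y ^ 3 / 6 * (1 / 2) ^ n" for n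
  proof -
    have "(fact 3 :: real) \<le> fact (n + 3)" by (intro fact_mono) simp
    then have f: "inverse (fact (n + 3)) \<le> (1 / 6 :: real)"
      by (simp add: eval_nat_numeral field_simps)
    have "norm (y ^ (n + 3)) \<le> norm y ^ (n + 3)" by (rule norm_power_ineq)
    also have "\<dots> \<le> (1 / 2) ^ n * norm y ^ 3"
      unfolding power_add by (intro mult_right_mono power_mono assms) auto
    finally have "inverse (fact (n + 3)) * norm (y ^ (n + 3)) \<le> 1 / 6 * ((1 / 2) ^ n * norm y ^ 3)"
      by (intro mult_mono f) auto
    then show ?thesis by (simp add: mult_ac)
  qed
  then have "norm (\<Sum>n. inverse (fact (n + 3)) *\<^sub>R (y ^ (n + 3))) \<le> (\<Sum>n. norm y ^ 3 / 6 * (1 / 2) ^ n)"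
    by (intro norm_suminf_le) (auto intro!: summable_mult summable_geometric)
  also have "\<dots> = norm y ^ 3 / 3"
    by (subst suminf_mult) (auto simp: suminf_geometric summable_geometric)
  finally show ?thesis by (simp only: eq)
qed

text \<open>
  These are the Fourier coefficients of \<open>exp (2 i r sin (l t + s))\<close>, with \<open>r = |z|\<close> and a phase \<open>s\<close>;
  up to factors of modulus \<open>1\<close>, values of Bessel functions at \<open>2 r\<close>. The Taylor expansion to second order is enough:
  the coefficient at \<open>0\<close> is about \<open>1 - r\<^sup>2\<close>, and the others are at most about \<open>r\<close>. With a
  remainder of at most \<open>(2/3) r\<^sup>2\<close>, the worst case is \<open>1 - r\<^sup>2/3\<close> at \<open>r = 1/16\<close>.
\<close>

lemma norm_coeff_exp_le:
  assumes l: "l > 0" and z: "1 / 16 \<le> cmod z" "cmod z \<le> 1 / 4"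
  shows "cmod (coeff (exp (single l z + single (- l) (- cnj z))) n) \<le> 767 / 768"
proof -
  define r y where "r = cmod z" and "y = single l z + single (- l) (- cnj z)"
  have "norm y \<le> cmod z + cmod (- cnj z)"
    unfolding y_def by (rule order_trans[OF norm_triangle_ineq]) simp
  then have ny: "norm y \<le> 2 * r" by (simp add: r_def)
  have r: "1 / 16 \<le> r" "r \<le> 1 / 4" using z by (auto simp: r_def)
  let ?R = "exp y - (1 + y + (1 / 2) *\<^sub>R (y * y))"
  have "norm ?R \<le> norm y ^ 3 / 3" by (rule norm_exp_remainder3_le) (use ny r in linarith)
  also have "\<dots> \<le> (2 * r) ^ 3 / 3" by (intro divide_right_mono power_mono ny) auto
  also have "\<dots> \<le> 2 / 3 * r\<^sup>2"
  proof -
    have "r\<^sup>2 * r \<le> r\<^sup>2 * (1 / 4)" using r by (intro mult_left_mono) auto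
    then show ?thesis by (simp add: power3_eq_cube power2_eq_square)
  qed
  finally have R: "cmod (coeff ?R n) \<le> 2 / 3 * r\<^sup>2" for n
    by (rule order_trans[OF norm_coeff_le])
  have zz: "z * cnj z = complex_of_real (r\<^sup>2)" unfolding r_def by (rule complex_norm_square[symmetric])
  have yy: "y * y = single (2 * l) (z * z) + single (- 2 * l) (cnj z * cnj z) + single 0 (- 2 * of_real (r\<^sup>2))"
  proof -
    have "y * y = single (l + l) (z * z) + single 0 (- (z * cnj z)) + (single 0 (- (z * cnj z)) + single (- l - l) (cnj z * cnj z))"
      unfolding y_def by (simp add: distrib_left distrib_right single_mult mult.commute)
    also have "\<dots> = single (2 * l) (z * z) + single (- 2 * l) (cnj z * cnj z)
        + (single 0 (- (z * cnj z)) + single 0 (- (z * cnj z)))"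
      by (simp add: algebra_simps)
    finally show ?thesis by (simp only: single_add zz) simp
  qed
  have split: "exp y = 1 + y + (1 / 2) *\<^sub>R (y * y) + ?R" by simp
  have sq: "1 / 256 \<le> r\<^sup>2" "r\<^sup>2 \<le> 1 / 16"
    using power_mono[OF r(1), of 2] power_mono[OF r(2), of 2] r by (auto simp: power2_eq_square)
  show ?thesis
  proof (cases "n = 0")
    case True
    have "coeff (exp y) 0 = complex_of_real (1 - r\<^sup>2) + coeff ?R 0"
      using l by (subst split) (simp add: coeff_one y_def yy[unfolded y_def] coeff_single)
    then have "cmod (coeff (exp y) 0) \<le> cmod (complex_of_real (1 - r\<^sup>2)) + cmod (coeff ?R 0)"
      by (metis norm_triangle_ineq)
    also have "\<dots> \<le> (1 - r\<^sup>2) + 2 / 3 * r\<^sup>2"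
      using sq by (intro add_mono R) (simp only: norm_of_real abs_of_nonneg)
    finally show ?thesis using sq True unfolding y_def by simp
  next
    case False
    have y: "cmod (coeff y n) \<le> r"
      using l by (auto simp: y_def coeff_single r_def)
    have "cmod (coeff (y * y) n) \<le> norm y * norm y"
      by (rule order_trans[OF norm_coeff_le norm_mult_ineq])
    also have "\<dots> \<le> (2 * r) * (2 * r)" by (intro mult_mono ny) (use r in auto)
    finally have yy: "cmod (coeff (y * y) n) \<le> 4 * r\<^sup>2" by (simp add: power2_eq_square)
    have "coeff (exp y) n = coeff y n + coeff (y * y) n / 2 + coeff ?R n"
      using False by (subst split) (simp add: coeff_one)
    then have "cmod (coeff (exp y) n) \<le> cmod (coeff y n) + cmod (coeff (y * y) n / 2) + cmod (coeff ?R n)"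
      by (metis norm_triangle_ineq norm_triangle_mono order_refl)
    also have "\<dots> \<le> r + 2 * r\<^sup>2 + 2 / 3 * r\<^sup>2"
      by (intro add_mono y R) (use yy in \<open>simp add: norm_divide\<close>)
    finally show ?thesis using sq r unfolding y_def by simp
  qed
qed

section \<open>A lacunary family of unitaries\<close>

text \<open>
  As a function on the circle, \<open>phase f w\<close> is \<open>i Re (cnj w f)\<close>. It is skew-adjoint and additive in
  \<open>w\<close>, so its exponentials are unitaries forming a homomorphic image of the plane.
\<close>

definition phase :: "wiener \<Rightarrow> complex \<Rightarrow> wiener" where
  "phase f w = single 0 (\<i> * cnj w / 2) * f + single 0 (\<i> * w / 2) * star f"

definition phase_unitary :: "wiener \<Rightarrow> complex \<Rightarrow> wiener" where
  "phase_unitary f w = exp (phase f w)"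

lemma coeff_phase: "coeff (phase f w) n = \<i> * cnj w / 2 * coeff f n + \<i> * w / 2 * cnj (coeff f (- n))"
  by (simp add: phase_def coeff_single_mult)

lemma star_phase: "star (phase f w) = - phase f w"
  by (rule wiener_eqI) (simp add: coeff_phase)

lemma phase_add: "phase (f + g) w = phase f w + phase g w"
  by (rule wiener_eqI) (simp add: coeff_phase algebra_simps add_divide_distrib)

lemma phase_add_right: "phase f (w + z) = phase f w + phase f z"
  by (rule wiener_eqI) (simp add: coeff_phase algebra_simps add_divide_distrib)

lemma phase_0: "phase f 0 = 0"
  by (rule wiener_eqI) (simp add: coeff_phase)

lemma phase_minus_right: "phase f (- w) = - phase f w"
  by (rule wiener_eqI) (simp add: coeff_phase algebra_simps)

lemma phase_single:
  "phase (single l (of_real c)) w =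
    single l (\<i> * c * cnj w / 2) + single (- l) (- cnj (\<i> * c * cnj w / 2))"
  by (rule wiener_eqI) (auto simp: coeff_phase coeff_single mult_ac)

lemma norm_phase_le: "norm (phase f w) \<le> cmod w * norm f"
proof -
  have "norm (phase f w) \<le> norm (single 0 (\<i> * cnj w / 2) * f) + norm (single 0 (\<i> * w / 2) * star f)"
    unfolding phase_def by (rule norm_triangle_ineq)
  also have "\<dots> \<le> cmod w / 2 * norm f + cmod w / 2 * norm f"
    using norm_mult_ineq[of "single 0 (\<i> * cnj w / 2)" f] norm_mult_ineq[of "single 0 (\<i> * w / 2)" "star f"]
    by (intro add_mono) (simp_all add: norm_mult norm_divide)
  finally show ?thesis by (simp add: mult.commute)
qed

lemma phase_unitary_add: "phase_unitary (f + g) w = phase_unitary f w * phase_unitary g w"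
  unfolding phase_unitary_def phase_add by (rule exp_add_commuting) (rule mult.commute)

lemma phase_unitary_add_right: "phase_unitary f (w + z) = phase_unitary f w * phase_unitary f z"
  unfolding phase_unitary_def phase_add_right by (rule exp_add_commuting) (rule mult.commute)

lemma phase_unitary_0: "phase_unitary f 0 = 1"
  by (simp add: phase_unitary_def phase_0)

lemma star_phase_unitary: "star (phase_unitary f w) = phase_unitary f (- w)"
  by (simp add: phase_unitary_def star_exp star_phase phase_minus_right)

lemma phase_unitary_unitary: "phase_unitary f w * star (phase_unitary f w) = 1"
  using phase_unitary_add_right[of f w "- w"] by (simp add: star_phase_unitary phase_unitary_0)

lemma norm_coeff_phase_unitary_le_1: "cmod (coeff (phase_unitary f w) n) \<le> 1"
  by (rule norm_coeff_unitary_le_1[OF phase_unitary_unitary])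

lemma norm_phase_unitary_le: "norm (phase_unitary f w) \<le> exp (cmod w * norm f)"
  unfolding phase_unitary_def by (rule order_trans[OF norm_exp]) (simp add: norm_phase_le)

text \<open>
  Adding a term of very high frequency \<open>l\<close> to \<open>f\<close> does not increase the supremum of the coefficients
  by more than the tail error, and up to that error it decreases it by a constant factor if \<open>c |w|\<close>
  is neither too small nor too large.
\<close>

lemma coeff_phase_unitary_step:
  assumes l: "l > 0" "2 * N < l" and c: "c \<ge> 0" "c * cmod w \<le> 1 / 2"
    and tail: "tail_le (phase_unitary f w) N e" and A: "\<And>n. cmod (coeff (phase_unitary f w) n) \<le> A"
  shows "cmod (coeff (phase_unitary (f + single l (of_real c)) w) n) \<le> A + e"
    and "c * cmod w \<ge> 1 / 8 \<Longrightarrow>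
      cmod (coeff (phase_unitary (f + single l (of_real c)) w) n) \<le> 767 / 768 * (A + e)"
proof -
  have supp: "supp_multiples l (phase_unitary (single l (of_real c)) w)"
    unfolding phase_unitary_def
    by (rule supp_multiples_exp) (auto simp: supp_multiples_def phase_single coeff_single)
  note step = norm_coeff_mult_sparse_le[OF tail l(2) A supp]
  show "cmod (coeff (phase_unitary (f + single l (of_real c)) w) n) \<le> A + e"
    using step[of 1 n] by (simp add: phase_unitary_add norm_coeff_phase_unitary_le_1)
  assume w: "c * cmod w \<ge> 1 / 8"
  have "cmod (coeff (phase_unitary (single l (of_real c)) w) n) \<le> 767 / 768" for n
    unfolding phase_unitary_def phase_single
    by (rule norm_coeff_exp_le[OF l(1)]) (use c w in \<open>simp_all add: norm_mult norm_divide\<close>)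
  then show "cmod (coeff (phase_unitary (f + single l (of_real c)) w) n) \<le> 767 / 768 * (A + e)"
    using step[of "767 / 768" n] by (simp add: phase_unitary_add)
qed

text \<open>
  The frequencies are chosen so that finitely many tail conditions hold at a time. This is where
  restricting \<open>w\<close> to Gaussian integers is convenient.
\<close>

lemma finite_gaussian_ball: "finite {w. \<exists>(p::int) (q::int). w = Complex p q \<and> cmod w \<le> r}"
proof (rule finite_subset)
  let ?B = "{- \<lceil>\<bar>r\<bar>\<rceil>..\<lceil>\<bar>r\<bar>\<rceil>}"
  show "{w. \<exists>(p::int) (q::int). w = Complex p q \<and> cmod w \<le> r} \<subseteq> (\<lambda>(p, q). Complex p q) ` (?B \<times> ?B)"
  proof (clarify)
    fix p q :: int assume *: "cmod (Complex p q) \<le> r"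
    have "p \<in> ?B" using abs_Re_le_cmod[of "Complex p q"] * by auto linarith+
    moreover have "q \<in> ?B" using abs_Im_le_cmod[of "Complex p q"] * by auto linarith+
    ultimately show "Complex p q \<in> (\<lambda>(p, q). Complex p q) ` (?B \<times> ?B)" by auto
  qed
qed auto

text \<open>
  The coefficients are summable, and yet the number of those between \<open>1/(8 r)\<close> and \<open>1/(2 r)\<close> grows
  like the square root of \<open>r\<close>.
\<close>

definition lac_coeff :: "nat \<Rightarrow> real" where
  "lac_coeff j = 1 / (real j + 1)\<^sup>2"

text \<open>
  The bound \<open>(j + 1)\<^sup>2 / 2\<close> on \<open>|w|\<close> means \<open>c\<^sub>j |w| \<le> 1/2\<close>. For larger \<open>w\<close> no tail condition is asked:
  there the low frequency part is only known to have coefficients of modulus at most \<open>1\<close>. Demanding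
  one frequency for all \<open>w\<close> would be too much, since the bandwidth grows with \<open>|w|\<close>. The error
  \<open>(1/2)\<^sup>j\<close> decays faster than the gain from the steps.
\<close>

definition lacunary_step :: "nat \<Rightarrow> wiener \<Rightarrow> wiener \<Rightarrow> bool" where
  "lacunary_step j g h \<longleftrightarrow> (\<exists>l>0. h = g + single l (of_real (lac_coeff j)) \<and>
     (\<exists>N. 2 * N < l \<and> (\<forall>(p::int) (q::int). cmod (Complex p q) \<le> (real j + 1)\<^sup>2 / 2 \<longrightarrow>
        tail_le (phase_unitary g (Complex p q)) N ((1 / 2) ^ j))))"

lemma lacunary_stepE:
  assumes "lacunary_step j g h" "cmod (Complex (of_int p) (of_int q)) \<le> (real j + 1)\<^sup>2 / 2"
  obtains l N where "l > 0" "h = g + single l (of_real (lac_coeff j))" "2 * N < l"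
    "tail_le (phase_unitary g (Complex (of_int p) (of_int q))) N ((1 / 2) ^ j)"
  using assms unfolding lacunary_step_def by blast

lemma lacunary_step_exists: "\<exists>h. lacunary_step j g h"
proof -
  let ?W = "phase_unitary g ` {w. \<exists>(p::int) (q::int). w = Complex p q \<and> cmod w \<le> (real j + 1)\<^sup>2 / 2}"
  obtain N where N: "N \<ge> 0" "\<forall>a\<in>?W. tail_le a N ((1 / 2) ^ j)"
    using ex_tail_le_finite[of "(1 / 2) ^ j" ?W] finite_gaussian_ball[of "(real j + 1)\<^sup>2 / 2"] by auto
  have "lacunary_step j g (g + single (2 * N + 1) (of_real (lac_coeff j)))"
    unfolding lacunary_step_def
    by (intro conjI exI[of _ "2 * N + 1"] exI[of _ N]) (use N in auto)
  then show ?thesis by blast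
qed

lemma lacunary_sequence_exists:
  "\<exists>f :: nat \<Rightarrow> wiener. f 0 = 0 \<and> (\<forall>j. lacunary_step j (f j) (f (Suc j)))"
  using dependent_nat_choice[of "\<lambda>n x. n = 0 \<longrightarrow> x = 0" lacunary_step] lacunary_step_exists
  by (metis nat.simps(3))

text \<open>
  Here \<open>k\<close> is the integer part of the square root of \<open>2 |w|\<close>. The steps \<open>j < k\<close> are ignored,
  because a product of unitaries has coefficients of modulus at most \<open>1\<close>. Each of the \<open>k\<close> steps from
  \<open>k\<close> to \<open>2 k - 1\<close> gains the factor \<open>767/768\<close>, and all later steps add only the geometric sum of
  the errors.
\<close>

lemma superpolynomial_decay_exists:
  "\<exists>f :: wiener. \<forall>(p::int) (q::int) (k::nat) n.
     (real k)\<^sup>2 \<le> 2 * cmod (Complex p q) \<longrightarrow> 2 * cmod (Complex p q) \<le> (real k + 1)\<^sup>2 \<longrightarrow>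
     cmod (coeff (phase_unitary f (Complex p q)) n) \<le> 9 * (767 / 768) ^ k"
proof -
  obtain f where f0: "f 0 = 0" and fS: "\<And>j. lacunary_step j (f j) (f (Suc j))"
    using lacunary_sequence_exists by blast
  have "summable (\<lambda>j. norm (f (Suc j) - f j))"
  proof -
    have "norm (f (Suc j) - f j) = inverse ((real (Suc j))\<^sup>2)" for j
    proof -
      obtain l where "f (Suc j) = f j + single l (of_real (lac_coeff j))"
        using fS[of j] unfolding lacunary_step_def by blast
      then have "norm (f (Suc j) - f j) = \<bar>lac_coeff j\<bar>"
        by (simp only: add_diff_cancel_left' norm_single norm_of_real)
      then show ?thesis by (simp add: lac_coeff_def inverse_eq_divide add.commute)
    qed
    moreover have "summable (\<lambda>j. inverse ((real (Suc j))\<^sup>2))"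
      by (subst summable_Suc_iff) (rule inverse_power_summable, simp)
    ultimately show ?thesis by simp
  qed
  then have "summable (\<lambda>j. f (Suc j) - f j)" by (rule summable_norm_cancel)
  then obtain g where "(\<lambda>j. f (Suc j) - f j) sums g" by (auto simp: summable_def)
  then have "f \<longlonglongrightarrow> g"
    by (simp add: sums_def sum_lessThan_telescope f0)
  have "cmod (coeff (phase_unitary g (Complex p q)) n) \<le> 9 * (767 / 768) ^ k"
    if k: "(real k)\<^sup>2 \<le> 2 * cmod (Complex p q)" "2 * cmod (Complex p q) \<le> (real k + 1)\<^sup>2"
    for p q :: int and k n
  proof -
    let ?w = "Complex p q"
    let ?s = "\<lambda>i. \<Sum>m<i. (1 / 2 :: real) ^ (k + m)"
    have r: "lac_coeff j * cmod ?w \<le> 1 / 2" "cmod ?w \<le> (real j + 1)\<^sup>2 / 2" if "k \<le> j" for j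
    proof -
      have "(real k + 1)\<^sup>2 \<le> (real j + 1)\<^sup>2" using that by (intro power_mono) auto
      then show *: "cmod ?w \<le> (real j + 1)\<^sup>2 / 2" using k by linarith
      show "lac_coeff j * cmod ?w \<le> 1 / 2"
        using * by (simp add: lac_coeff_def divide_le_eq)
    qed
    \<comment> \<open>For these \<open>j\<close>, \<open>(j + 1)\<^sup>2 \<le> 4 k\<^sup>2 \<le> 8 |w|\<close>.\<close>
    have low: "1 / 8 \<le> lac_coeff j * cmod ?w" if "k \<le> j" "j < 2 * k" for j
    proof -
      have "(real j + 1)\<^sup>2 \<le> (2 * real k)\<^sup>2" using that by (intro power_mono) auto
      also have "\<dots> \<le> 8 * cmod ?w" using k by (simp add: power2_eq_square)
      finally show ?thesis by (simp add: lac_coeff_def field_simps)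
    qed
    have lac: "lac_coeff j \<ge> 0" for j by (simp add: lac_coeff_def)
    have 1: "cmod (coeff (phase_unitary (f (k + i)) ?w) n) \<le> (767 / 768) ^ i + ?s i" if "i \<le> k" for i n
      using that
    proof (induction i arbitrary: n)
      case 0
      then show ?case by (simp add: norm_coeff_phase_unitary_le_1)
    next
      case (Suc i)
      obtain l N where lN: "l > 0" "f (Suc (k + i)) = f (k + i) + single l (of_real (lac_coeff (k + i)))"
        "2 * N < l" "tail_le (phase_unitary (f (k + i)) ?w) N ((1 / 2) ^ (k + i))"
        using lacunary_stepE[OF fS[of "k + i"] r(2)] by auto
      have "cmod (coeff (phase_unitary (f (Suc (k + i))) ?w) n) \<le> 767 / 768 * ((767 / 768) ^ i + ?s i + (1 / 2) ^ (k + i))"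
        unfolding lN(2)
        by (rule coeff_phase_unitary_step(2)[OF lN(1,3) lac _ lN(4)]) (use Suc r low in auto)
      also have "\<dots> \<le> (767 / 768) ^ Suc i + ?s (Suc i)"
        by (simp add: sum_nonneg distrib_left)
           (intro add_mono mult_left_le_one_le; simp add: sum_nonneg)
      finally show ?case by simp
    qed
    have 2: "cmod (coeff (phase_unitary (f (2 * k + i)) ?w) n) \<le> (767 / 768) ^ k + ?s (k + i)" for i n
    proof (induction i arbitrary: n)
      case 0
      then show ?case using 1[of k n] by (simp add: mult_2)
    next
      case (Suc i)
      obtain l N where lN: "l > 0" "f (Suc (2 * k + i)) = f (2 * k + i) + single l (of_real (lac_coeff (2 * k + i)))"
        "2 * N < l" "tail_le (phase_unitary (f (2 * k + i)) ?w) N ((1 / 2) ^ (2 * k + i))"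
        using lacunary_stepE[OF fS[of "2 * k + i"] r(2)] by auto
      have "cmod (coeff (phase_unitary (f (Suc (2 * k + i))) ?w) n) \<le> ((767 / 768) ^ k + ?s (k + i)) + (1 / 2) ^ (2 * k + i)"
        unfolding lN(2)
        by (rule coeff_phase_unitary_step(1)[OF lN(1,3) lac _ lN(4)]) (use Suc r in auto)
      then show ?case by (simp add: mult_2 add_ac)
    qed
    have s: "?s i \<le> 2 * (767 / 768) ^ k" for i
    proof -
      have "?s i = (1 / 2) ^ k * (\<Sum>m<i. (1 / 2) ^ m)"
        by (simp add: power_add sum_distrib_left)
      also have "\<dots> \<le> (767 / 768) ^ k * 2"
        by (intro mult_mono power_mono) (auto simp: sum_gp_strict sum_nonneg power_le_one)
      finally show ?thesis by simp
    qed
    \<comment> \<open>The remaining infinite tail of \<open>f\<close> is so small that it costs at most a factor \<open>e < 3\<close>.\<close>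
    have "(\<lambda>J. cmod ?w * norm (g - f J)) \<longlonglongrightarrow> cmod ?w * norm (g - g)"
      by (intro tendsto_intros \<open>f \<longlonglongrightarrow> g\<close>)
    then have "eventually (\<lambda>J. cmod ?w * norm (g - f J) < 1) sequentially"
      by (rule order_tendstoD) simp
    with eventually_ge_at_top[of "2 * k"]
    have "eventually (\<lambda>J. 2 * k \<le> J \<and> cmod ?w * norm (g - f J) < 1) sequentially"
      by (rule eventually_conj)
    then obtain J where J: "2 * k \<le> J" "cmod ?w * norm (g - f J) < 1"
      unfolding eventually_sequentially by blast
    have A: "cmod (coeff (phase_unitary (f J) ?w) n) \<le> 3 * (767 / 768) ^ k" for n
      using 2[of "J - 2 * k" n] s[of "k + (J - 2 * k)"] J(1) by simp
    have "phase_unitary g ?w = phase_unitary (f J) ?w * phase_unitary (g - f J) ?w"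
      by (simp flip: phase_unitary_add)
    then have "cmod (coeff (phase_unitary g ?w) n) \<le> 3 * (767 / 768) ^ k * norm (phase_unitary (g - f J) ?w)"
      using norm_coeff_mult_le[OF A, of "phase_unitary (g - f J) ?w" n] by simp
    also have "norm (phase_unitary (g - f J) ?w) \<le> exp 1"
      by (rule order_trans[OF norm_phase_unitary_le]) (use J(2) in simp)
    also have "exp 1 \<le> (3::real)" by (rule exp_le)
    finally show ?thesis by (simp add: mult_left_mono)
  qed
  then show ?thesis by blast
qed

lemma polynomial_decay_exists:
  "\<exists>f C. \<forall>(p::int) (q::int) n.
     cmod (coeff (phase_unitary f (Complex p q)) n) * (1 + cmod (Complex p q)) * ((1 + (real_of_int p)\<^sup>2) * (1 + (real_of_int q)\<^sup>2)) \<le> C"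
proof -
  obtain f where f: "\<And>(p::int) (q::int) (k::nat) n.
     (real k)\<^sup>2 \<le> 2 * cmod (Complex p q) \<Longrightarrow> 2 * cmod (Complex p q) \<le> (real k + 1)\<^sup>2 \<Longrightarrow>
     cmod (coeff (phase_unitary f (Complex p q)) n) \<le> 9 * (767 / 768) ^ k"
    using superpolynomial_decay_exists by blast
  have "(\<lambda>k. 72 * (real k + 1) ^ 10 * (767 / 768) ^ k) \<longlonglongrightarrow> 0"
  proof -
    \<comment> \<open>Taking tenth roots reduces the claim to the convergence of \<open>k x\<^sup>k\<close> to \<open>0\<close>.\<close>
    define x :: real where "x = root 10 (767 / 768)"
    have x: "0 < x" "x < 1" "x ^ 10 = 767 / 768"
      by (simp_all add: x_def)
    have "(\<lambda>k. 72 * (real k * x ^ k + x ^ k) ^ 10) \<longlonglongrightarrow> 72 * (0 + 0) ^ 10"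
      using x by (intro tendsto_intros powser_times_n_limit_0 LIMSEQ_power_zero) auto
    also have "(\<lambda>k. 72 * (real k * x ^ k + x ^ k) ^ 10) = (\<lambda>k. 72 * (real k + 1) ^ 10 * (767 / 768) ^ k)"
    proof
      fix k
      have "(real k * x ^ k + x ^ k) ^ 10 = ((real k + 1) * x ^ k) ^ 10" by (simp add: distrib_right)
      also have "\<dots> = (real k + 1) ^ 10 * (x ^ 10) ^ k"
        by (simp only: power_mult_distrib power_mult[symmetric] mult.commute)
      finally show "72 * (real k * x ^ k + x ^ k) ^ 10 = 72 * (real k + 1) ^ 10 * (767 / 768) ^ k"
        by (simp only: x(3) mult.assoc)
    qed
    finally show ?thesis by simp
  qed
  then have bounded: "Bseq (\<lambda>k. 72 * (real k + 1) ^ 10 * (767 / 768) ^ k)"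
    by (intro convergent_imp_Bseq convergentI)
  obtain C where C: "\<forall>k. norm (72 * (real k + 1) ^ 10 * (767 / 768) ^ k) \<le> C"
    by (rule BseqE[OF bounded])
  have "cmod (coeff (phase_unitary f (Complex p q)) n) * (1 + cmod (Complex p q)) * ((1 + (real_of_int p)\<^sup>2) * (1 + (real_of_int q)\<^sup>2)) \<le> C"
    for p q :: int and n
  proof -
    define r where "r = cmod (Complex p q)"
    define k where "k = nat \<lfloor>sqrt (2 * r)\<rfloor>"
    have r0: "r \<ge> 0" by (simp add: r_def)
    then have "real k \<le> sqrt (2 * r)" "sqrt (2 * r) \<le> real k + 1"
      by (auto simp: k_def)
    then have k: "(real k)\<^sup>2 \<le> 2 * r" "2 * r \<le> (real k + 1)\<^sup>2"
      using r0 power_mono[of "real k" "sqrt (2 * r)" 2] power_mono[of "sqrt (2 * r)" "real k + 1" 2] by auto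
    define K where "K = real k + 1"
    have K: "K \<ge> 1" "r \<le> K\<^sup>2" "1 \<le> K\<^sup>2" "1 \<le> K ^ 4"
      using k r0 by (auto simp: K_def one_le_power)
    have pq: "(real_of_int x)\<^sup>2 \<le> K ^ 4" if "\<bar>real_of_int x\<bar> \<le> r" for x
      using power_mono[of "\<bar>real_of_int x\<bar>" "K\<^sup>2" 2] that K by simp
    have "cmod (coeff (phase_unitary f (Complex p q)) n) \<le> 9 * (767 / 768) ^ k"
      using f[of k p q n] k by (simp add: r_def)
    moreover have "1 + r \<le> 2 * K\<^sup>2" using K by linarith
    moreover have "1 + (real_of_int p)\<^sup>2 \<le> 2 * K ^ 4" "1 + (real_of_int q)\<^sup>2 \<le> 2 * K ^ 4"
      using pq[of p] pq[of q] abs_Re_le_cmod[of "Complex p q"] abs_Im_le_cmod[of "Complex p q"] K(4)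
      by (simp_all add: r_def)
    ultimately have "cmod (coeff (phase_unitary f (Complex p q)) n) * (1 + r) * ((1 + (real_of_int p)\<^sup>2) * (1 + (real_of_int q)\<^sup>2))
        \<le> 9 * (767 / 768) ^ k * (2 * K\<^sup>2) * ((2 * K ^ 4) * (2 * K ^ 4))"
      using r0 K(1) by (intro mult_mono) (auto intro!: mult_nonneg_nonneg)
    also have "\<dots> = 72 * K ^ 10 * (767 / 768) ^ k" by (simp add: eval_nat_numeral)
    also have "\<dots> \<le> C" using C[rule_format, of k] by (simp add: K_def)
    finally show ?thesis by (simp add: r_def)
  qed
  then show ?thesis by blast
qed

section \<open>A bounded sequence annihilated by an element but not by its adjoint\<close>

lemma summable_inverse_one_plus_square_int: "(\<lambda>p::int. 1 / (1 + (real_of_int p)\<^sup>2)) summable_on UNIV"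
proof -
  let ?h = "\<lambda>p::int. 1 / (1 + (real_of_int p)\<^sup>2)"
  have "summable (\<lambda>n::nat. 1 / (1 + (real n)\<^sup>2))"
  proof (rule summable_comparison_test)
    show "summable (\<lambda>n. inverse ((real n)\<^sup>2))" by (rule inverse_power_summable) simp
    show "\<exists>N. \<forall>n\<ge>N. norm (1 / (1 + (real n)\<^sup>2)) \<le> inverse ((real n)\<^sup>2)"
      by (intro exI[of _ 1]) (auto simp: inverse_eq_divide intro!: divide_left_mono mult_pos_pos add_pos_nonneg)
  qed
  then have nat: "(\<lambda>n::nat. 1 / (1 + (real n)\<^sup>2)) summable_on UNIV"
    by (rule summable_nonneg_imp_summable_on) simp
  have "?h summable_on range int"
    by (subst summable_on_reindex) (use nat in \<open>simp_all add: o_def\<close>)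
  moreover have "?h summable_on range (\<lambda>n. - int n)"
    by (subst summable_on_reindex) (use nat in \<open>simp_all add: o_def inj_on_def\<close>)
  ultimately have "?h summable_on (range int \<union> range (\<lambda>n. - int n))" by (rule summable_on_union)
  moreover have "p \<in> range int \<union> range (\<lambda>n. - int n)" for p
    by (cases p rule: int_cases2) auto
  then have "range int \<union> range (\<lambda>n. - int n) = UNIV" by blast
  ultimately show ?thesis by simp
qed

definition gauss :: "int \<times> int \<Rightarrow> complex" where
  "gauss x = Complex (fst x) (snd x)"

lemma gauss_add: "gauss (x + y) = gauss x + gauss y"
  and gauss_0: "gauss 0 = 0"
  by (auto simp: gauss_def complex_eq_iff)

lemma norm_gauss_ge_1: "x \<noteq> 0 \<Longrightarrow> 1 \<le> cmod (gauss x)"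
proof -
  assume "x \<noteq> 0"
  then have "fst x \<noteq> 0 \<or> snd x \<noteq> 0" by (auto simp: prod_eq_iff)
  then have "1 \<le> \<bar>real_of_int (fst x)\<bar> \<or> 1 \<le> \<bar>real_of_int (snd x)\<bar>" by linarith
  then show ?thesis
    using abs_Re_le_cmod[of "gauss x"] abs_Im_le_cmod[of "gauss x"] by (auto simp: gauss_def)
qed

text \<open>
  Passing from \<open>w\<close> to \<open>L w\<close> leaves the unitary at \<open>w = 0\<close> equal to \<open>1\<close> and divides the bounds on
  all the others by \<open>L\<close>, so that the sum of the zeroth coefficients is close to \<open>1\<close> for large \<open>L\<close>.
\<close>

lemma summable_unitary_family_exists:
  "\<exists>(v :: complex \<Rightarrow> wiener) M. (\<forall>w z. v (w + z) = v w * v z) \<and> v 0 = 1 \<and> (\<forall>w. star (v w) = v (- w)) \<and>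
     M summable_on UNIV \<and> (\<forall>x n. (1 + cmod (gauss x)) * cmod (coeff (v (gauss x)) n) \<le> M x) \<and>
     (\<Sum>\<^sub>\<infinity>x. coeff (v (gauss x)) 0) \<noteq> 0"
proof -
  obtain f C where fC: "\<And>(p::int) (q::int) n. cmod (coeff (phase_unitary f (Complex p q)) n) * (1 + cmod (Complex p q))
      * ((1 + (real_of_int p)\<^sup>2) * (1 + (real_of_int q)\<^sup>2)) \<le> C"
    using polynomial_decay_exists by blast
  let ?h = "\<lambda>p::int. 1 / (1 + (real_of_int p)\<^sup>2)"
  define H where "H = (\<lambda>x. ?h (fst x) * ?h (snd x))"
  have H0: "H x \<ge> 0" for x by (simp add: H_def)
  have H: "H summable_on UNIV"
    using has_sum_imp_summable[OF product_family_has_sum[of ?h ?h]] summable_inverse_one_plus_square_int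
    by (simp add: H_def case_prod_unfold)
  have C: "C \<ge> 0" using fC[of 0 0 0] order_trans[OF _ fC[of 0 0 0], of 0] by simp
  define D where "D = infsum H UNIV"
  have D: "D \<ge> 0" unfolding D_def by (rule infsum_nonneg) (rule H0)
  obtain L :: nat where L: "real L > C * D + 1" using reals_Archimedean2 by blast
  have CD: "C * D \<ge> 0" using C D by simp
  have L1: "real L \<ge> 1" using L CD by linarith
  define v where "v w = phase_unitary f (of_nat L * w)" for w
  have scale: "cmod (coeff (v (gauss x)) n) * (1 + L * cmod (gauss x)) \<le> C * H x" for x n
  proof -
    obtain p q where x: "x = (p, q)" by fastforce
    have eq: "of_nat L * gauss x = Complex (of_int (int L * p)) (of_int (int L * q))"
      by (simp add: x gauss_def complex_eq_iff)
    have sq: "1 + (real_of_int y)\<^sup>2 \<le> 1 + (real_of_int (int L * y))\<^sup>2" for y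
    proof -
      have "1 * (real_of_int y)\<^sup>2 \<le> (real L)\<^sup>2 * (real_of_int y)\<^sup>2"
        using L1 by (intro mult_right_mono) (auto simp: one_le_power)
      then show ?thesis by (simp add: power_mult_distrib)
    qed
    have "cmod (coeff (v (gauss x)) n) * (1 + L * cmod (gauss x)) * ((1 + (real_of_int p)\<^sup>2) * (1 + (real_of_int q)\<^sup>2))
        \<le> cmod (coeff (v (gauss x)) n) * (1 + L * cmod (gauss x))
          * ((1 + (real_of_int (int L * p))\<^sup>2) * (1 + (real_of_int (int L * q))\<^sup>2))"
      by (intro mult_left_mono mult_mono sq) auto
    also have "\<dots> \<le> C"
    proof -
      have "L * cmod (gauss x) = cmod (of_nat L * gauss x)" by (simp add: norm_mult)
      then show ?thesis using fC[of "int L * p" "int L * q" n] unfolding v_def eq by (simp only:)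
    qed
    finally show ?thesis
      by (simp add: H_def x pos_le_divide_eq add_pos_nonneg)
  qed
  define M where "M x = C * H x" for x
  have M: "M summable_on UNIV" unfolding M_def by (intro summable_on_cmult_right H)
  have vM: "(1 + cmod (gauss x)) * cmod (coeff (v (gauss x)) n) \<le> M x" for x n
  proof -
    have "1 * cmod (gauss x) \<le> L * cmod (gauss x)" by (intro mult_right_mono L1) auto
    then have "cmod (coeff (v (gauss x)) n) * (1 + cmod (gauss x)) \<le> cmod (coeff (v (gauss x)) n) * (1 + L * cmod (gauss x))"
      by (intro mult_left_mono) auto
    then show ?thesis using scale[of x n] by (simp add: M_def mult.commute)
  qed
  have far: "cmod (coeff (v (gauss x)) n) \<le> C / L * H x" if "x \<noteq> 0" for x n
  proof -
    have "real L * 1 \<le> L * cmod (gauss x)" by (intro mult_left_mono norm_gauss_ge_1 that) auto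
    then have "cmod (coeff (v (gauss x)) n) * L \<le> cmod (coeff (v (gauss x)) n) * (1 + L * cmod (gauss x))"
      by (intro mult_left_mono) auto
    then have "cmod (coeff (v (gauss x)) n) * L \<le> C * H x" using scale[of x n] by linarith
    then show ?thesis using L1 by (simp add: pos_le_divide_eq)
  qed
  have v0: "v 0 = 1" by (simp add: v_def phase_unitary_0)
  let ?s = "\<lambda>x. coeff (v (gauss x)) 0"
  have H_far: "(\<lambda>x. C / L * H x) summable_on - {0}"
    by (intro summable_on_cmult_right summable_on_subset_banach[OF H]) simp
  have far_abs: "?s abs_summable_on - {0}"
    by (rule summable_on_comparison_test[OF H_far far]) auto
  then have far_sum: "?s summable_on - {0}" by (rule Infinite_Sum.abs_summable_summable)
  have "cmod (infsum ?s (- {0})) \<le> (\<Sum>\<^sub>\<infinity>x\<in>- {0}. C / L * H x)"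
    by (rule order_trans[OF norm_infsum_bound[OF far_abs]], rule infsum_mono[OF far_abs])
       (use far H_far in auto)
  also have "\<dots> \<le> (\<Sum>\<^sub>\<infinity>x. C / L * H x)"
    by (rule infsum_mono2[OF H_far summable_on_cmult_right[OF H]]) (use H0 C in auto)
  also have "\<dots> = C / L * D" unfolding D_def by (rule infsum_cmult_right')
  also have "\<dots> < 1" using L L1 by (simp add: pos_divide_less_eq)
  finally have small: "cmod (infsum ?s (- {0})) < 1" .
  have "infsum ?s UNIV = infsum ?s (insert 0 (- {0}))" by (simp add: insert_UNIV Compl_insert)
  also have "\<dots> = 1 + infsum ?s (- {0})"
    by (subst infsum_insert[OF far_sum]) (simp_all add: gauss_0 v0 coeff_one)
  finally have "infsum ?s UNIV \<noteq> 0"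
    using small by (metis add_eq_0_iff norm_minus_cancel norm_one order_less_irrefl)
  moreover have "v (w + z) = v w * v z" "star (v w) = v (- w)" for w z
    by (simp_all add: v_def distrib_left phase_unitary_add_right star_phase_unitary)
  ultimately show ?thesis using v0 M vM by blast
qed

text \<open>
  The sequence \<open>T\<close> is the sum of the unitaries \<open>v\<^sub>w\<close> weighted by \<open>w\<close>. Reindexing gives
  \<open>v\<^sub>c T = T - c S\<close> for the unweighted sum \<open>S\<close>, and \<open>g = (v\<^sub>1 - 1) + i (v\<^sub>i - 1)\<close> is the combination
  in which the multiples of \<open>S\<close> cancel, while they add up for \<open>g\<^sup>*\<close>.
\<close>

lemma annihilator_not_self_adjoint_exists:
  "\<exists>(g :: wiener) T B. (\<forall>n. cmod (T n) \<le> B) \<and> (\<forall>n. (\<Sum>\<^sub>\<infinity>m. coeff g (n - m) * T m) = 0) \<and>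
     (\<Sum>\<^sub>\<infinity>m. cnj (coeff g m) * T m) \<noteq> 0"
proof -
  obtain v :: "complex \<Rightarrow> wiener" and M where v_add: "\<And>w z. v (w + z) = v w * v z" and v0: "v 0 = 1"
    and star_v: "\<And>w. star (v w) = v (- w)" and M: "M summable_on UNIV"
    and vM: "\<And>x n. (1 + cmod (gauss x)) * cmod (coeff (v (gauss x)) n) \<le> M x"
    and nz: "(\<Sum>\<^sub>\<infinity>x. coeff (v (gauss x)) 0) \<noteq> 0"
    using summable_unitary_family_exists by blast
  have vM1: "cmod (coeff (v (gauss x)) n) \<le> M x" "cmod (gauss x * coeff (v (gauss x)) n) \<le> M x" for x n
  proof -
    have "0 \<le> cmod (gauss x) * cmod (coeff (v (gauss x)) n)" "0 \<le> cmod (coeff (v (gauss x)) n)" by simp_all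
    then show "cmod (coeff (v (gauss x)) n) \<le> M x" "cmod (gauss x * coeff (v (gauss x)) n) \<le> M x"
      using vM[of x n] unfolding distrib_right norm_mult by linarith+
  qed
  have M0: "M x \<ge> 0" for x using order_trans[OF norm_ge_zero vM1(1)] .
  define T where "T n = (\<Sum>\<^sub>\<infinity>x. gauss x * coeff (v (gauss x)) n)" for n
  define S where "S n = (\<Sum>\<^sub>\<infinity>x. coeff (v (gauss x)) n)" for n
  define act where "act a n = (\<Sum>\<^sub>\<infinity>m. coeff a (n - m) * T m)" for a n
  have S_sum: "(\<lambda>x. coeff (v (gauss x)) n) summable_on UNIV" for n
    by (rule Infinite_Sum.abs_summable_summable, rule summable_on_comparison_test[OF M]) (use vM1 in auto)
  have T_abs: "(\<lambda>x. gauss x * coeff (v (gauss x)) n) abs_summable_on UNIV" for n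
    by (rule summable_on_comparison_test[OF M]) (use vM1 in auto)
  note T_sum = Infinite_Sum.abs_summable_summable[OF T_abs]
  have T_bound: "cmod (T n) \<le> infsum M UNIV" for n
    unfolding T_def
    by (rule order_trans[OF norm_infsum_bound[OF T_abs]], rule infsum_mono[OF T_abs M]) (rule vM1)
  have act_sum: "(\<lambda>x. gauss x * coeff (a * v (gauss x)) n) summable_on UNIV" for a n
  proof (rule Infinite_Sum.abs_summable_summable, rule summable_on_comparison_test)
    show "(\<lambda>x. M x * norm a) summable_on UNIV" by (intro summable_on_cmult_left M)
    fix x
    have "cmod (coeff (single 0 (gauss x) * v (gauss x) * a) n) \<le> M x * norm a"
      by (rule norm_coeff_mult_le) (simp add: coeff_single_mult vM1)
    then show "cmod (gauss x * coeff (a * v (gauss x)) n) \<le> M x * norm a"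
      by (simp add: coeff_single_mult mult.assoc mult.commute[of a])
  qed simp
  have act: "act a n = (\<Sum>\<^sub>\<infinity>x. gauss x * coeff (a * v (gauss x)) n)" for a n
  proof -
    have bij: "bij_betw (\<lambda>m. n - m) (UNIV :: int set) UNIV"
      by (rule bij_betw_byWitness[where f' = "\<lambda>k. n - k"]) auto
    have "(\<lambda>m. cmod (coeff a (n - m))) summable_on UNIV"
      using summable_on_reindex_bij_betw[OF bij, of "\<lambda>k. cmod (coeff a k)"] coeff_abs_summable[of a] by simp
    from has_sum_imp_summable[OF product_family_has_sum[OF this _ M M0]]
    have "(\<lambda>(m, x). cmod (coeff a (n - m)) * M x) summable_on UNIV" by simp
    then have "(\<lambda>(m, x). coeff a (n - m) * (gauss x * coeff (v (gauss x)) m)) abs_summable_on UNIV"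
    proof (rule summable_on_comparison_test)
      fix y :: "int \<times> (int \<times> int)"
      obtain m x where y: "y = (m, x)" by (cases y)
      show "cmod (case y of (m, x) \<Rightarrow> coeff a (n - m) * (gauss x * coeff (v (gauss x)) m))
          \<le> (case y of (m, x) \<Rightarrow> cmod (coeff a (n - m)) * M x)"
        unfolding y prod.case norm_mult[of "coeff a (n - m)"] by (intro mult_left_mono vM1) simp
    qed simp
    then have "(\<lambda>(m, x). coeff a (n - m) * (gauss x * coeff (v (gauss x)) m)) summable_on UNIV \<times> UNIV"
      using Infinite_Sum.abs_summable_summable by (simp only: UNIV_Times_UNIV)
    note swap = infsum_swap_banach[OF this]
    have inner: "(\<Sum>\<^sub>\<infinity>m. coeff a (n - m) * (gauss x * coeff (v (gauss x)) m)) = gauss x * coeff (a * v (gauss x)) n" for x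
    proof -
      have "(\<Sum>\<^sub>\<infinity>m. coeff a (n - m) * (gauss x * coeff (v (gauss x)) m))
          = (\<Sum>\<^sub>\<infinity>m. gauss x * (coeff (v (gauss x)) m * coeff a (n - m)))"
        by (simp only: mult_ac)
      also have "\<dots> = gauss x * coeff (v (gauss x) * a) n"
        by (simp only: infsum_cmult_right' times_wiener.rep_eq)
      finally show ?thesis by (simp only: mult.commute)
    qed
    have "act a n = (\<Sum>\<^sub>\<infinity>m. \<Sum>\<^sub>\<infinity>x. coeff a (n - m) * (gauss x * coeff (v (gauss x)) m))"
      unfolding act_def T_def by (simp only: infsum_cmult_right')
    then show ?thesis by (simp only: swap inner)
  qed
  have act_add: "act (a + b) n = act a n + act b n" for a b n
    unfolding act distrib_right coeff_simps distrib_left by (rule infsum_add[OF act_sum act_sum])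
  have act_scale: "act (single 0 c * a) n = c * act a n" for c a n
  proof -
    have "gauss x * coeff (single 0 c * a * v (gauss x)) n = c * (gauss x * coeff (a * v (gauss x)) n)" for x
      by (simp add: mult.assoc coeff_single_mult)
    then show ?thesis unfolding act by (simp only: infsum_cmult_right')
  qed
  have act_1: "act 1 n = T n" for n unfolding act T_def by simp
  have act_diff: "act (a - b) n = act a n - act b n" for a b n
    using act_add[of "a - b" b n] by simp
  have act_v: "act (v (gauss c)) n = T n - gauss c * S n" for c n
  proof -
    have bij: "bij_betw (\<lambda>x. c + x) (UNIV :: (int \<times> int) set) UNIV"
      by (rule bij_betw_byWitness[where f' = "\<lambda>x. x - c"]) auto
    have "act (v (gauss c)) n = (\<Sum>\<^sub>\<infinity>x. (gauss (c + x) - gauss c) * coeff (v (gauss (c + x))) n)"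
      unfolding act by (simp add: gauss_add v_add)
    also have "\<dots> = (\<Sum>\<^sub>\<infinity>x. (gauss x - gauss c) * coeff (v (gauss x)) n)"
      by (rule infsum_reindex_bij_betw[OF bij])
    also have "\<dots> = (\<Sum>\<^sub>\<infinity>x. gauss x * coeff (v (gauss x)) n + (- gauss c) * coeff (v (gauss x)) n)"
      by (simp add: left_diff_distrib)
    also have "\<dots> = T n + (- gauss c) * S n"
      unfolding T_def S_def
      by (simp only: infsum_add[OF T_sum summable_on_cmult_right[OF S_sum]] infsum_cmult_right')
    finally show ?thesis by simp
  qed
  define g where "g = (v (gauss (1, 0)) - 1) + single 0 \<i> * (v (gauss (0, 1)) - 1)"
  have g1: "gauss (1, 0) = 1" "gauss (0, 1) = \<i>" "gauss (- 1, 0) = - 1" "gauss (0, - 1) = - \<i>"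
    by (auto simp: gauss_def complex_eq_iff)
  have "act g n = 0" for n
    unfolding g_def act_add act_scale act_diff act_1 act_v by (simp add: g1)
  moreover have "act (star g) 0 = 2 * S 0"
  proof -
    have "star g = (v (gauss (- 1, 0)) - 1) + single 0 (- \<i>) * (v (gauss (0, - 1)) - 1)"
      by (simp add: g_def star_add star_diff star_mult star_single star_v g1)
    then show ?thesis
      by (simp only: act_add act_scale act_diff act_1 act_v) (simp add: g1 algebra_simps)
  qed
  moreover have "act (star g) 0 = (\<Sum>\<^sub>\<infinity>m. cnj (coeff g m) * T m)"
    by (simp add: act_def)
  ultimately show ?thesis
    using T_bound nz unfolding act_def S_def by (intro exI[of _ g] exI[of _ T] exI[of _ "infsum M UNIV"]) auto
qed

section \<open>Elements and closed ideals of the algebra\<close>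

lemma int_iterate_shift:
  assumes "bij \<sigma>"
  shows "int_iterate \<sigma> (k + 1) x = \<sigma> (int_iterate \<sigma> k x)"
proof (cases "k \<ge> 0")
  case True
  then have "nat (k + 1) = Suc (nat k)" by simp
  then show ?thesis using True by (simp add: int_iterate_def)
next
  case False
  then have eq: "nat (- k) = Suc (nat (- (k + 1)))" by simp
  have "\<sigma> (int_iterate \<sigma> k x) = (inv \<sigma> ^^ nat (- (k + 1))) x"
    unfolding int_iterate_def using False
    by (simp add: eq surj_f_inv_f[OF bij_is_surj[OF assms]] del: nat_minus_as_int)
  also have "\<dots> = int_iterate \<sigma> (k + 1) x"
    using False by (cases "k = - 1") (simp_all add: int_iterate_def)
  finally show ?thesis by simp
qed

lemma int_iterate_0 [simp]: "int_iterate \<sigma> 0 x = x"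
  by (simp add: int_iterate_def)

lemma int_iterate_add:
  assumes "bij \<sigma>"
  shows "int_iterate \<sigma> (k + l) x = int_iterate \<sigma> k (int_iterate \<sigma> l x)"
proof (induction k rule: int_induct[where k = 0])
  case (step1 i)
  have "int_iterate \<sigma> (i + 1 + l) x = \<sigma> (int_iterate \<sigma> (i + l) x)"
    using int_iterate_shift[OF assms, of "i + l" x] by (simp add: algebra_simps)
  then show ?case by (simp only: step1 int_iterate_shift[OF assms])
next
  case (step2 i)
  have "\<sigma> (int_iterate \<sigma> (i - 1 + l) x) = int_iterate \<sigma> (i + l) x"
    using int_iterate_shift[OF assms, of "i - 1 + l" x] by (simp add: algebra_simps)
  also have "\<dots> = \<sigma> (int_iterate \<sigma> (i - 1) (int_iterate \<sigma> l x))"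
    using int_iterate_shift[OF assms, of "i - 1" "int_iterate \<sigma> l x"] by (simp add: step2)
  finally show ?case using bij_is_inj[OF assms] by (simp add: inj_eq)
qed simp

lemma bij_of_homeomorphism:
  assumes "homeomorphism UNIV UNIV \<sigma> (inv \<sigma>)"
  shows "bij \<sigma>"
  by (rule o_bij[of "inv \<sigma>"]) (use assms in \<open>auto simp: homeomorphism_def\<close>)

lemma apply_l1_mult:
  assumes "homeomorphism UNIV UNIV \<sigma> (inv \<sigma>)" "a \<in> l1" "b \<in> l1"
  shows "apply_bcontfun (l1_mult \<sigma> a b n) x
    = (\<Sum>\<^sub>\<infinity>k. apply_bcontfun (a k) x * apply_bcontfun (b (n - k)) (int_iterate \<sigma> (- k) x))"
  unfolding l1_mult_def abs_summable_bcontfun(2)[OF l1_mult_summable(1)[OF assms]]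
  by (simp only: times_bcontfun.rep_eq apply_int_iterate_alpha[OF assms(1)])

lemma l1_convolution_summable:
  assumes "a \<in> l1" "b \<in> l1"
  shows "(\<lambda>(n, k). norm (a k) * norm (b (n - k))) summable_on UNIV"
  using has_sum_imp_summable[OF convolution_family_has_sum[of "\<lambda>k. norm (a k)" "\<lambda>k. norm (b k)"]] assms
  by (simp add: l1_def)

lemma l1_mult_closed:
  assumes hom: "homeomorphism UNIV UNIV \<sigma> (inv \<sigma>)" and a: "a \<in> l1" and b: "b \<in> l1"
  shows "l1_mult \<sigma> a b \<in> l1"
proof -
  have "(\<lambda>(n, k). norm (a k) * norm (b (n - k))) abs_summable_on UNIV"
    using l1_convolution_summable[OF a b] by (simp add: case_prod_unfold)
  note slices = abs_summable_slices[OF this]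
  have "norm (l1_mult \<sigma> a b n) \<le> (\<Sum>\<^sub>\<infinity>k. norm (norm (a k) * norm (b (n - k))))" for n
  proof (rule norm_bound)
    fix x
    let ?h = "\<lambda>k. apply_bcontfun (a k) x * apply_bcontfun (b (n - k)) (int_iterate \<sigma> (- k) x)"
    have le: "norm (?h k) \<le> norm (norm (a k) * norm (b (n - k)))" for k
      by (simp add: norm_mult mult_mono norm_bounded)
    have "?h abs_summable_on UNIV"
      by (rule summable_on_comparison_test[OF slices(1) le]) simp
    from norm_infsum_bound[OF this] infsum_mono[OF this slices(1) le]
    show "norm (apply_bcontfun (l1_mult \<sigma> a b n) x) \<le> (\<Sum>\<^sub>\<infinity>k. norm (norm (a k) * norm (b (n - k))))"
      unfolding apply_l1_mult[OF assms] by linarith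
  qed
  then show ?thesis
    unfolding l1_def using summable_on_comparison_test[OF slices(2)] by simp
qed

lemma l1_add_closed: "a \<in> l1 \<Longrightarrow> b \<in> l1 \<Longrightarrow> (\<lambda>n. a n + b n) \<in> l1"
  unfolding l1_def by (simp add: abs_summable_plus)

lemma l1_minus_closed: "a \<in> l1 \<Longrightarrow> b \<in> l1 \<Longrightarrow> (\<lambda>n. a n - b n) \<in> l1"
  unfolding l1_def by (simp add: abs_summable_minus)

lemma norm_const_bcontfun_le: "norm (const_bcontfun c) \<le> norm c"
  by (rule norm_bound) (simp add: const_bcontfun.rep_eq)

lemma l1_scale_closed:
  assumes "a \<in> l1"
  shows "(\<lambda>n. const_bcontfun c * a n) \<in> l1"
proof -
  have "(\<lambda>n. norm c * norm (a n)) summable_on UNIV"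
    using assms by (auto simp: l1_def intro: summable_on_cmult_right)
  then have "(\<lambda>n. norm (const_bcontfun c * a n)) summable_on UNIV"
  proof (rule summable_on_comparison_test)
    show "norm (const_bcontfun c * a n) \<le> norm c * norm (a n)" for n
      by (rule order_trans[OF norm_mult_ineq]) (intro mult_right_mono norm_const_bcontfun_le norm_ge_zero)
  qed simp
  then show ?thesis by (simp add: l1_def)
qed

lemma closedin_l1_iff:
  "closedin (Metric_space.mtopology l1 l1_dist) I \<longleftrightarrow>
     I \<subseteq> l1 \<and> (\<forall>a\<in>l1. (\<forall>e>0. \<exists>b\<in>I. l1_dist a b < e) \<longrightarrow> a \<in> I)"
  unfolding Metric_space.closedin_metric[OF Metric_space_l1] disjnt_iff
    Metric_space.in_mball[OF Metric_space_l1]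
  by (auto; meson subsetD)

lemma l1_tail_small:
  assumes "a \<in> l1" "e > 0"
  shows "\<exists>F. finite F \<and> (\<forall>G. finite G \<longrightarrow> G \<inter> F = {} \<longrightarrow> (\<Sum>n\<in>G. norm (a n)) \<le> e)"
proof -
  have sum: "(\<lambda>n. norm (a n)) summable_on UNIV" using assms(1) by (simp add: l1_def)
  obtain F where F: "finite F" "\<bar>(\<Sum>n\<in>F. norm (a n)) - l1_norm a\<bar> \<le> e"
    using infsum_finite_approximation[OF sum assms(2)] by (auto simp: l1_norm_def dist_real_def)
  have "(\<Sum>n\<in>G. norm (a n)) \<le> e" if "finite G" "G \<inter> F = {}" for G
  proof -
    have "(\<Sum>n\<in>F \<union> G. norm (a n)) \<le> l1_norm a"
      unfolding l1_norm_def by (rule finite_sum_le_infsum[OF sum]) (use F that in auto)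
    then show ?thesis using F that by (simp add: sum.union_disjoint Int_commute)
  qed
  then show ?thesis using F(1) by blast
qed

lemma l1_dist_leI:
  assumes "\<And>G. finite G \<Longrightarrow> (\<Sum>n\<in>G. norm (a n - b n)) \<le> e"
  shows "l1_dist a b \<le> e"
  unfolding l1_dist_def l1_norm_def by (rule abs_summable_finite_boundI(2)[OF assms])

lemma closed_l1_idealD:
  assumes "closed_l1_ideal \<sigma> I" "a \<in> l1" "\<And>e. e > 0 \<Longrightarrow> \<exists>b\<in>I. l1_dist a b \<le> e"
  shows "a \<in> I"
proof -
  have "\<exists>b\<in>I. l1_dist a b < e" if "e > 0" for e
  proof -
    have "e / 2 > 0" using that by simp
    from assms(3)[OF this] obtain b where "b \<in> I" "l1_dist a b \<le> e / 2" by blast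
    then show ?thesis using that by (intro bexI[of _ b]) auto
  qed
  then show ?thesis using assms by (auto simp: closed_l1_ideal_def closedin_l1_iff)
qed

section \<open>The ideal attached to a periodic point\<close>

text \<open>
  On the restriction of \<open>a\<close> to a residue class modulo \<open>d\<close>, evaluated at the point \<open>y\<close>, this is the
  convolution with \<open>T\<close>.
\<close>

definition periodic_pairing ::
    "nat \<Rightarrow> (int \<Rightarrow> complex) \<Rightarrow> (int \<Rightarrow> 'a::topological_space \<Rightarrow>\<^sub>C complex) \<Rightarrow> int \<Rightarrow> 'a \<Rightarrow> complex" where
  "periodic_pairing d T a n y = (\<Sum>\<^sub>\<infinity>m. apply_bcontfun (a (n - int d * m)) y * T m)"

definition periodic_ideal ::
    "('a::topological_space \<Rightarrow> 'a) \<Rightarrow> 'a \<Rightarrow> nat \<Rightarrow> (int \<Rightarrow> complex) \<Rightarrow> (int \<Rightarrow> 'a \<Rightarrow>\<^sub>C complex) set" where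
  "periodic_ideal \<sigma> x d T = {a \<in> l1. \<forall>i n. periodic_pairing d T a n (int_iterate \<sigma> i x) = 0}"

context
  fixes d :: nat and T :: "int \<Rightarrow> complex" and B :: real
  assumes d: "d \<ge> 1" and T: "\<And>m. cmod (T m) \<le> B"
begin

lemma periodic_pairing_abs_summable:
  assumes "a \<in> l1"
  shows "(\<lambda>m. apply_bcontfun (a (n - int d * m)) y * T m) abs_summable_on UNIV"
    and "cmod (periodic_pairing d T a n y) \<le> l1_norm a * B"
proof -
  have B: "B \<ge> 0" using order_trans[OF norm_ge_zero T] .
  let ?r = "\<lambda>m. n - int d * m"
  have inj: "inj ?r" using d by (auto simp: inj_on_def)
  have a: "(\<lambda>k. norm (a k)) summable_on UNIV" using assms by (simp add: l1_def)
  have "(\<lambda>k. norm (a k)) summable_on range ?r" by (rule summable_on_subset_banach[OF a]) simp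
  then have r: "(\<lambda>m. norm (a (?r m))) summable_on UNIV"
    by (simp add: summable_on_reindex[OF inj] o_def)
  have "(\<Sum>\<^sub>\<infinity>m. norm (a (?r m))) = (\<Sum>\<^sub>\<infinity>k\<in>range ?r. norm (a k))"
    by (simp add: infsum_reindex[OF inj] o_def)
  also have "\<dots> \<le> l1_norm a"
    unfolding l1_norm_def by (rule infsum_mono2[OF summable_on_subset_banach[OF a] a]) auto
  finally have sum_le: "(\<Sum>\<^sub>\<infinity>m. norm (a (?r m))) \<le> l1_norm a" .
  have le: "cmod (apply_bcontfun (a (?r m)) y * T m) \<le> norm (a (?r m)) * B" for m
    unfolding norm_mult by (intro mult_mono norm_bounded T) auto
  note rB = summable_on_cmult_left[OF r, of B]
  show *: "(\<lambda>m. apply_bcontfun (a (n - int d * m)) y * T m) abs_summable_on UNIV"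
    by (rule summable_on_comparison_test[OF rB le]) simp
  have "cmod (periodic_pairing d T a n y) \<le> (\<Sum>\<^sub>\<infinity>m. norm (a (?r m)) * B)"
    unfolding periodic_pairing_def
    by (rule order_trans[OF norm_infsum_bound[OF *] infsum_mono[OF * rB le]])
  also have "\<dots> = (\<Sum>\<^sub>\<infinity>m. norm (a (?r m))) * B" by (rule infsum_cmult_left')
  also have "\<dots> \<le> l1_norm a * B" by (rule mult_right_mono[OF sum_le B])
  finally show "cmod (periodic_pairing d T a n y) \<le> l1_norm a * B" .
qed

lemma periodic_pairing_summable:
  "a \<in> l1 \<Longrightarrow> (\<lambda>m. apply_bcontfun (a (n - int d * m)) y * T m) summable_on UNIV"
  by (rule Infinite_Sum.abs_summable_summable[OF periodic_pairing_abs_summable(1)])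

lemma periodic_pairing_add:
  "a \<in> l1 \<Longrightarrow> b \<in> l1 \<Longrightarrow>
    periodic_pairing d T (\<lambda>n. a n + b n) n y = periodic_pairing d T a n y + periodic_pairing d T b n y"
  unfolding periodic_pairing_def
  by (simp add: distrib_right infsum_add periodic_pairing_summable)

lemma periodic_pairing_scale:
  "periodic_pairing d T (\<lambda>n. const_bcontfun c * a n) n y = c * periodic_pairing d T a n y"
  unfolding periodic_pairing_def
  by (simp add: times_bcontfun.rep_eq const_bcontfun.rep_eq mult.assoc infsum_cmult_right')

text \<open>
  A pairing with a product is a combination of pairings with either factor. For the right factor only
  the order of summation changes, and the pairings are taken at other points of the orbit of \<open>y\<close>. For the left
  factor the index of summation is moved by \<open>d m\<close>, which does not change the points of the orbit
  because \<open>y\<close> has period \<open>d\<close>.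
\<close>

lemma periodic_pairing_l1_mult:
  assumes hom: "homeomorphism UNIV UNIV \<sigma> (inv \<sigma>)" and a: "a \<in> l1" and b: "b \<in> l1"
  shows "periodic_pairing d T (l1_mult \<sigma> a b) n y
    = (\<Sum>\<^sub>\<infinity>k. apply_bcontfun (a k) y * periodic_pairing d T b (n - k) (int_iterate \<sigma> (- k) y))"
    and "int_iterate \<sigma> (int d) y = y \<Longrightarrow> periodic_pairing d T (l1_mult \<sigma> a b) n y
    = (\<Sum>\<^sub>\<infinity>k. apply_bcontfun (b (n - k)) (int_iterate \<sigma> (- k) y) * periodic_pairing d T a k y)"
proof -
  let ?f = "\<lambda>m k. apply_bcontfun (a k) y
      * apply_bcontfun (b (n - int d * m - k)) (int_iterate \<sigma> (- k) y) * T m"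
  have fam: "(\<lambda>(m, k). norm (a (s m k)) * norm (b (n - int d * m - s m k)) * B) summable_on UNIV"
    if s: "\<And>m. inj (s m)" for s :: "int \<Rightarrow> int \<Rightarrow> int"
  proof -
    let ?r = "\<lambda>(m, k). (n - int d * m, s m k)"
    have inj: "inj ?r" using d s by (auto simp: inj_on_def)
    have "(\<lambda>(n, k). norm (a k) * norm (b (n - k))) summable_on range ?r"
      by (rule summable_on_subset_banach[OF l1_convolution_summable[OF a b]]) simp
    then have "(\<lambda>(m, k). norm (a (s m k)) * norm (b (n - int d * m - s m k))) summable_on UNIV"
      unfolding summable_on_reindex[OF inj] by (simp add: o_def case_prod_unfold)
    from summable_on_cmult_left[OF this, of B] show ?thesis by (simp add: case_prod_unfold)
  qed
  have sum: "(\<lambda>(m, k). ?f m (s m k)) summable_on UNIV \<times> UNIV" if s: "\<And>m. inj (s m)" for s :: "int \<Rightarrow> int \<Rightarrow> int"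
  proof -
    have "(\<lambda>(m, k). ?f m (s m k)) abs_summable_on UNIV"
    proof (rule summable_on_comparison_test[OF fam[OF s]])
      fix p :: "int \<times> int"
      obtain m k where p: "p = (m, k)" by (cases p)
      show "cmod (case p of (m, k) \<Rightarrow> ?f m (s m k))
          \<le> (case p of (m, k) \<Rightarrow> norm (a (s m k)) * norm (b (n - int d * m - s m k)) * B)"
        unfolding p prod.case norm_mult by (intro mult_mono norm_bounded T mult_nonneg_nonneg norm_ge_zero)
    qed simp
    then show ?thesis using Infinite_Sum.abs_summable_summable by (simp only: UNIV_Times_UNIV)
  qed
  have start: "periodic_pairing d T (l1_mult \<sigma> a b) n y = (\<Sum>\<^sub>\<infinity>m. \<Sum>\<^sub>\<infinity>k. ?f m k)"
    unfolding periodic_pairing_def apply_l1_mult[OF assms] by (simp only: infsum_cmult_left')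
  also have "\<dots> = (\<Sum>\<^sub>\<infinity>k. \<Sum>\<^sub>\<infinity>m. ?f m k)"
    by (rule infsum_swap_banach) (rule sum[of "\<lambda>_ k. k"], simp)
  also have "\<dots> = (\<Sum>\<^sub>\<infinity>k. apply_bcontfun (a k) y * periodic_pairing d T b (n - k) (int_iterate \<sigma> (- k) y))"
  proof -
    have "n - int d * m - k = n - k - int d * m" for m k by simp
    then show ?thesis unfolding periodic_pairing_def by (simp only: mult.assoc infsum_cmult_right')
  qed
  finally show "periodic_pairing d T (l1_mult \<sigma> a b) n y
    = (\<Sum>\<^sub>\<infinity>k. apply_bcontfun (a k) y * periodic_pairing d T b (n - k) (int_iterate \<sigma> (- k) y))" .
  assume per: "int_iterate \<sigma> (int d) y = y"
  note bij = bij_of_homeomorphism[OF hom]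
  have per': "int_iterate \<sigma> (int d * m) y = y" for m
  proof (induction m rule: int_induct[where k = 0])
    case (step1 i)
    then show ?case using int_iterate_add[OF bij, of "int d * i" "int d" y] by (simp add: per distrib_left)
  next
    case (step2 i)
    then show ?case using int_iterate_add[OF bij, of "int d * (i - 1)" "int d" y]
      by (simp add: per algebra_simps)
  qed simp
  have shift: "?f m (k - int d * m) = apply_bcontfun (b (n - k)) (int_iterate \<sigma> (- k) y)
      * (apply_bcontfun (a (k - int d * m)) y * T m)" for m k
  proof -
    have "int_iterate \<sigma> (- (k - int d * m)) y = int_iterate \<sigma> (- k) y"
      using int_iterate_add[OF bij, of "- k" "int d * m" y] by (simp add: per')
    moreover have "n - int d * m - (k - int d * m) = n - k" by simp
    ultimately show ?thesis by (simp only: mult_ac)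
  qed
  have "(\<Sum>\<^sub>\<infinity>k. ?f m k) = (\<Sum>\<^sub>\<infinity>k. ?f m (k - int d * m))" for m
  proof -
    have "bij_betw (\<lambda>k. k - int d * m) (UNIV :: int set) UNIV"
      by (rule bij_betw_byWitness[where f' = "\<lambda>k. k + int d * m"]) auto
    from infsum_reindex_bij_betw[OF this, of "?f m"] show ?thesis by simp
  qed
  then have "periodic_pairing d T (l1_mult \<sigma> a b) n y = (\<Sum>\<^sub>\<infinity>m. \<Sum>\<^sub>\<infinity>k. ?f m (k - int d * m))"
    unfolding start by simp
  also have "\<dots> = (\<Sum>\<^sub>\<infinity>k. \<Sum>\<^sub>\<infinity>m. ?f m (k - int d * m))"
    by (rule infsum_swap_banach) (rule sum[of "\<lambda>m k. k - int d * m"], simp add: inj_on_def)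
  also have "\<dots> = (\<Sum>\<^sub>\<infinity>k. apply_bcontfun (b (n - k)) (int_iterate \<sigma> (- k) y) * periodic_pairing d T a k y)"
    unfolding shift periodic_pairing_def by (simp only: infsum_cmult_right')
  finally show "periodic_pairing d T (l1_mult \<sigma> a b) n y
    = (\<Sum>\<^sub>\<infinity>k. apply_bcontfun (b (n - k)) (int_iterate \<sigma> (- k) y) * periodic_pairing d T a k y)" .
qed

lemma closed_l1_ideal_periodic_ideal:
  assumes hom: "homeomorphism UNIV UNIV \<sigma> (inv \<sigma>)" and per: "(\<sigma> ^^ d) x = x"
  shows "closed_l1_ideal \<sigma> (periodic_ideal \<sigma> x d T)"
proof -
  note bij = bij_of_homeomorphism[OF hom]
  let ?I = "periodic_ideal \<sigma> x d T"
  have orbit: "int_iterate \<sigma> (int d) (int_iterate \<sigma> i x) = int_iterate \<sigma> i x" for i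
  proof -
    have "int_iterate \<sigma> (int d) (int_iterate \<sigma> i x) = int_iterate \<sigma> i (int_iterate \<sigma> (int d) x)"
      by (simp only: int_iterate_add[OF bij, symmetric] add.commute)
    also have "int_iterate \<sigma> (int d) x = x" using per by (simp add: int_iterate_def)
    finally show ?thesis .
  qed
  have "l1_ideal \<sigma> ?I"
    unfolding l1_ideal_def
  proof (intro conjI ballI allI)
    show "(\<lambda>n. 0) \<in> ?I" by (simp add: periodic_ideal_def l1_def periodic_pairing_def)
  next
    fix a b assume "a \<in> ?I" "b \<in> ?I"
    then show "(\<lambda>n. a n + b n) \<in> ?I"
      by (simp add: periodic_ideal_def l1_add_closed periodic_pairing_add)
  next
    fix c a assume "a \<in> ?I"
    then show "(\<lambda>n. const_bcontfun c * a n) \<in> ?I"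
      by (simp add: periodic_ideal_def l1_scale_closed periodic_pairing_scale)
  next
    fix a b :: "int \<Rightarrow> 'a \<Rightarrow>\<^sub>C complex" assume a: "a \<in> ?I" and b: "b \<in> l1"
    then have a': "a \<in> l1" by (simp add: periodic_ideal_def)
    show "l1_mult \<sigma> b a \<in> ?I"
      using a by (simp add: periodic_ideal_def l1_mult_closed[OF hom] a' b periodic_pairing_l1_mult(1)[OF hom]
          flip: int_iterate_add[OF bij])
    show "l1_mult \<sigma> a b \<in> ?I"
      using a by (simp add: periodic_ideal_def l1_mult_closed[OF hom] a' b
          periodic_pairing_l1_mult(2)[OF hom _ _ orbit])
  qed (simp add: periodic_ideal_def)
  moreover have "closedin (Metric_space.mtopology l1 l1_dist) ?I"
    unfolding closedin_l1_iff
  proof (intro conjI ballI impI)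
    fix a assume a: "a \<in> l1" and approx: "\<forall>e>0. \<exists>b\<in>?I. l1_dist a b < e"
    have "periodic_pairing d T a n (int_iterate \<sigma> i x) = 0" for i n
    proof -
      let ?y = "int_iterate \<sigma> i x"
      have B: "B \<ge> 0" using order_trans[OF norm_ge_zero T] .
      have "cmod (periodic_pairing d T a n ?y) \<le> e" if "e > 0" for e
      proof -
        have "e / (B + 1) > 0" using that B by simp
        then obtain b where b: "b \<in> ?I" "l1_dist a b < e / (B + 1)" using approx by blast
        have b': "b \<in> l1" "periodic_pairing d T b n ?y = 0" using b(1) by (auto simp: periodic_ideal_def)
        have "periodic_pairing d T (\<lambda>n. (a n - b n) + b n) n ?y
            = periodic_pairing d T (\<lambda>n. a n - b n) n ?y + periodic_pairing d T b n ?y"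
          by (rule periodic_pairing_add) (intro l1_minus_closed a b')+
        then have "periodic_pairing d T a n ?y = periodic_pairing d T (\<lambda>n. a n - b n) n ?y" by (simp add: b')
        then have "cmod (periodic_pairing d T a n ?y) \<le> l1_dist a b * B"
          using periodic_pairing_abs_summable(2)[OF l1_minus_closed[OF a b'(1)], of n ?y] by (simp add: l1_dist_def)
        also have "\<dots> \<le> e / (B + 1) * B" using b(2) B by (intro mult_right_mono) auto
        also have "\<dots> \<le> e" using that B by (simp add: field_simps)
        finally show ?thesis .
      qed
      then have "cmod (periodic_pairing d T a n ?y) \<le> 0" by (rule field_le_epsilon) simp
      then show ?thesis by simp
    qed
    then show "a \<in> ?I" using a by (simp add: periodic_ideal_def)
  qed (auto simp: periodic_ideal_def)
  ultimately show ?thesis by (simp add: closed_l1_ideal_def)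
qed

end

text \<open>
  The witness is the copy of \<open>g\<close> with constant coefficients in the degrees divisible by \<open>d\<close>. On such
  elements the pairing is the convolution with \<open>T\<close>, and the involution is that of \<open>\<ell>\<^sup>1(\<int>)\<close>.
\<close>

lemma not_free_imp_not_self_adjoint:
  fixes \<sigma> :: "'a::topological_space \<Rightarrow> 'a"
  assumes hom: "homeomorphism UNIV UNIV \<sigma> (inv \<sigma>)" and "\<not> free_system \<sigma>"
  shows "\<exists>I. closed_l1_ideal \<sigma> I \<and> \<not> self_adjoint \<sigma> I"
proof -
  obtain x and d :: nat where d: "d \<ge> 1" "(\<sigma> ^^ d) x = x"
    using assms(2) by (auto simp: free_system_def)
  obtain g :: wiener and T B where T: "\<And>n. cmod (T n) \<le> B"
    and g: "\<And>n. (\<Sum>\<^sub>\<infinity>m. coeff g (n - m) * T m) = 0"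
    and g_star: "(\<Sum>\<^sub>\<infinity>m. cnj (coeff g m) * T m) \<noteq> 0"
    using annihilator_not_self_adjoint_exists by blast
  let ?I = "periodic_ideal \<sigma> x d T"
  define a :: "int \<Rightarrow> 'a \<Rightarrow>\<^sub>C complex"
    where "a k = (if int d dvd k then const_bcontfun (coeff g (k div int d)) else 0)" for k
  have a_l1: "a \<in> l1"
  proof -
    let ?r = "\<lambda>m. int d * m"
    let ?c = "\<lambda>k. if int d dvd k then cmod (coeff g (k div int d)) else 0"
    have inj: "inj ?r" using d by (auto simp: inj_on_def)
    have "?c summable_on range ?r"
      using coeff_abs_summable[of g] d by (simp add: summable_on_reindex[OF inj] o_def)
    moreover have "?c k = 0" if "k \<notin> range ?r" for k using that by (auto elim: dvdE)
    ultimately have "?c summable_on UNIV"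
      by (subst summable_on_cong_neutral[where T = "range ?r"]) auto
    then show ?thesis
      unfolding l1_def mem_Collect_eq
      by (rule summable_on_comparison_test) (auto simp: a_def norm_const_bcontfun_le)
  qed
  have "a \<in> ?I"
  proof -
    have "periodic_pairing d T a n y = 0" for n y
    proof (cases "int d dvd n")
      case True
      then obtain j where n: "n = int d * j" by (elim dvdE)
      have "a (n - int d * m) = const_bcontfun (coeff g (j - m))" for m
        using d by (simp add: a_def n flip: right_diff_distrib)
      then show ?thesis by (simp add: periodic_pairing_def const_bcontfun.rep_eq g)
    next
      case False
      then have "\<not> int d dvd n - int d * m" for m by (metis diff_add_cancel dvd_add dvd_triv_left)
      then show ?thesis by (simp add: periodic_pairing_def a_def)
    qed
    then show ?thesis using a_l1 by (simp add: periodic_ideal_def)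
  qed
  moreover have "l1_star \<sigma> a \<notin> ?I"
  proof
    assume "l1_star \<sigma> a \<in> ?I"
    then have "\<forall>i n. periodic_pairing d T (l1_star \<sigma> a) n (int_iterate \<sigma> i x) = 0"
      by (simp add: periodic_ideal_def)
    then have "periodic_pairing d T (l1_star \<sigma> a) 0 (int_iterate \<sigma> 0 x) = 0" by blast
    moreover have "apply_bcontfun (l1_star \<sigma> a (0 - int d * m)) y = cnj (coeff g m)" for m y
      using d by (simp add: l1_star_def cnj_bcontfun.rep_eq apply_int_iterate_alpha[OF hom] a_def const_bcontfun.rep_eq)
    ultimately show False using g_star by (simp add: periodic_pairing_def)
  qed
  ultimately have "\<not> self_adjoint \<sigma> ?I" by (auto simp: self_adjoint_def)
  moreover have "closed_l1_ideal \<sigma> ?I"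
    by (rule closed_l1_ideal_periodic_ideal[OF d(1) T hom d(2)])
  ultimately show ?thesis by blast
qed

section \<open>Free systems\<close>

definition l1_single :: "int \<Rightarrow> ('a::topological_space \<Rightarrow>\<^sub>C complex) \<Rightarrow> int \<Rightarrow> 'a \<Rightarrow>\<^sub>C complex" where
  "l1_single k f n = (if n = k then f else 0)"

lemma finite_support_l1:
  assumes "finite F" "\<And>n. n \<notin> F \<Longrightarrow> a n = 0"
  shows "a \<in> l1"
proof -
  have "{n. norm (a n) \<noteq> 0} \<subseteq> F" using assms(2) by auto
  then have "finite {n. norm (a n) \<noteq> 0}" by (rule finite_subset) (rule assms(1))
  then show ?thesis
    unfolding l1_def mem_Collect_eq by (intro finite_nonzero_values_imp_summable_on) simp
qed

lemma l1_single_l1: "l1_single k f \<in> l1"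
  by (rule finite_support_l1[of "{k}"]) (auto simp: l1_single_def)

context
  fixes \<sigma> :: "'a::t2_space \<Rightarrow> 'a"
  assumes comp: "compact (UNIV :: 'a set)" and hom: "homeomorphism UNIV UNIV \<sigma> (inv \<sigma>)"
begin

lemma int_iterate_alpha_0: "int_iterate (alpha \<sigma>) k 0 = 0"
  by (rule bcontfun_eqI) (simp add: apply_int_iterate_alpha[OF hom])

lemma l1_mult_single_left:
  "l1_mult \<sigma> (l1_single k f) b n = f * int_iterate (alpha \<sigma>) k (b (n - k))"
  unfolding l1_mult_def
  by (subst infsum_single_support[of k]) (simp_all add: l1_single_def)

lemma l1_mult_single_right:
  "l1_mult \<sigma> a (l1_single k f) n = a (n - k) * int_iterate (alpha \<sigma>) (n - k) f"
  unfolding l1_mult_def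
  by (subst infsum_single_support[of "n - k"]) (simp_all add: l1_single_def int_iterate_alpha_0)

lemma ex_bcontfun:
  fixes h :: "'a \<Rightarrow> complex"
  assumes "continuous_on UNIV h"
  shows "\<exists>g. \<forall>x. apply_bcontfun g x = h x"
proof -
  have "bounded (range h)"
    using compact_continuous_image[OF assms comp] by (rule compact_imp_bounded)
  then have "h \<in> bcontfun" using assms by (simp add: bcontfun_def)
  then show ?thesis by (metis Bcontfun_inverse)
qed

lemma continuous_on_int_iterate: "continuous_on UNIV (int_iterate \<sigma> k)"
proof -
  have cont: "continuous_on UNIV \<sigma>" "continuous_on UNIV (inv \<sigma>)"
    using hom by (auto simp: homeomorphism_def)
  have pow: "continuous_on UNIV (h ^^ n)" if "continuous_on UNIV h" for h :: "'a \<Rightarrow> 'a" and n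
  proof (induction n)
    case (Suc n)
    then show ?case
      unfolding funpow.simps by (intro continuous_on_compose continuous_on_subset[OF that]) auto
  qed (simp add: id_def)
  show ?thesis by (simp add: int_iterate_def[abs_def] pow cont)
qed

text \<open>
  A compact Hausdorff space is normal, so this is Urysohn's lemma for two points.
\<close>

lemma ex_separating_function:
  fixes x y :: 'a
  assumes "x \<noteq> y"
  shows "\<exists>f :: 'a \<Rightarrow> real. continuous_on UNIV f \<and> f x = 0 \<and> f y = 1"
proof -
  have "Hausdorff_space (euclidean :: 'a topology)"
    unfolding Hausdorff_space_def disjnt_def using hausdorff by (simp, blast)
  moreover have "compact_space (euclidean :: 'a topology)"
    unfolding compact_space_def using comp by simp
  ultimately have "normal_space (euclidean :: 'a topology)"
    by (intro compact_Hausdorff_or_regular_imp_normal_space) auto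
  then obtain f :: "'a \<Rightarrow> real" where "continuous_map euclidean (top_of_set {0..1}) f" "f ` {x} \<subseteq> {0}" "f ` {y} \<subseteq> {1}"
    using Urysohn_lemma[of euclidean "{x}" "{y}" 0 1] assms by (auto simp: disjnt_def)
  then show ?thesis
    by (intro exI[of _ f]) (auto simp: continuous_map_in_subtopology)
qed

text \<open>
  A function that separates \<open>y\<close> from \<open>\<sigma>\<^sup>-\<^sup>n y\<close> is clamped so that it is constant near both points, and
  then becomes the phase of \<open>\<theta>\<close>.
\<close>

lemma ex_local_sign_flip:
  assumes "y \<noteq> int_iterate \<sigma> (- n) y"
  shows "\<exists>V \<theta>. open V \<and> y \<in> V \<and> (\<forall>x. cmod (apply_bcontfun \<theta> x) = 1) \<and>
    (\<forall>x\<in>V. apply_bcontfun \<theta> x = 1 \<and> apply_bcontfun \<theta> (int_iterate \<sigma> (- n) x) = - 1)"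
proof -
  obtain f :: "'a \<Rightarrow> real" where f: "continuous_on UNIV f" "f y = 0" "f (int_iterate \<sigma> (- n) y) = 1"
    using ex_separating_function[OF assms] by blast
  have f': "continuous_on UNIV (\<lambda>x. f (int_iterate \<sigma> (- n) x))"
    by (rule continuous_on_compose2[OF f(1) continuous_on_int_iterate]) simp
  define g where "g x = max 0 (min 1 (3 * f x - 1))" for x
  have "continuous_on UNIV (\<lambda>x. cis (pi * g x))"
    unfolding g_def by (intro continuous_intros f)
  then obtain \<theta> where \<theta>: "\<And>x. apply_bcontfun \<theta> x = cis (pi * g x)"
    using ex_bcontfun by blast
  let ?V = "{x. f x < 1 / 3} \<inter> {x. 2 / 3 < f (int_iterate \<sigma> (- n) x)}"
  have "open ?V"
    by (intro open_Int open_Collect_less f f' continuous_on_const)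
  moreover have "y \<in> ?V" by (simp add: f)
  moreover have "apply_bcontfun \<theta> x = 1 \<and> apply_bcontfun \<theta> (int_iterate \<sigma> (- n) x) = - 1" if "x \<in> ?V" for x
    using that by (auto simp: \<theta> g_def)
  ultimately show ?thesis by (intro exI[of _ ?V] exI[of _ \<theta>]) (simp add: \<theta>)
qed

text \<open>
  Domination is required pointwise, not only for norms, so that a coefficient keeps the zeros that it
  has already acquired.
\<close>

definition compresses :: "(int \<Rightarrow> 'a \<Rightarrow>\<^sub>C complex) \<Rightarrow> (int \<Rightarrow> 'a \<Rightarrow>\<^sub>C complex) \<Rightarrow> bool" where
  "compresses b a \<longleftrightarrow> b 0 = a 0 \<and> (\<forall>m x. cmod (apply_bcontfun (b m) x) \<le> cmod (apply_bcontfun (a m) x))"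

lemma compresses_trans: "compresses c b \<Longrightarrow> compresses b a \<Longrightarrow> compresses c a"
  unfolding compresses_def by (metis order_trans)

lemma compresses_zero: "compresses b a \<Longrightarrow> apply_bcontfun (a m) x = 0 \<Longrightarrow> apply_bcontfun (b m) x = 0"
  unfolding compresses_def by (metis norm_le_zero_iff norm_zero)

text \<open>
  Conjugation by \<open>\<theta>\<close> multiplies the \<open>m\<close>-th coefficient by \<open>\<theta>(x) cnj (\<theta>(\<sigma>\<^sup>-\<^sup>m x))\<close>, which is \<open>1\<close> for
  \<open>m = 0\<close> and has modulus \<open>1\<close> in general.
\<close>

lemma compress_by_unitary:
  assumes I: "l1_ideal \<sigma> I" and a: "a \<in> I" and \<theta>: "\<And>x. cmod (apply_bcontfun \<theta> x) = 1"
  shows "\<exists>b\<in>I. compresses b a \<and> (\<forall>m x. apply_bcontfun (b m) x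
    = (1 + apply_bcontfun \<theta> x * cnj (apply_bcontfun \<theta> (int_iterate \<sigma> (- m) x))) / 2 * apply_bcontfun (a m) x)"
proof -
  define c where "c = l1_mult \<sigma> (l1_mult \<sigma> (l1_single 0 \<theta>) a) (l1_single 0 (cnj_bcontfun \<theta>))"
  define b where "b m = const_bcontfun (1 / 2) * (a m + c m)" for m
  have "c \<in> I" using I a by (simp add: c_def l1_ideal_def l1_single_l1)
  then have "(\<lambda>n. a n + c n) \<in> I" using I a by (simp add: l1_ideal_def)
  then have b: "b \<in> I" using I by (simp add: b_def[abs_def] l1_ideal_def)
  let ?u = "\<lambda>m x. apply_bcontfun \<theta> x * cnj (apply_bcontfun \<theta> (int_iterate \<sigma> (- m) x))"
  have formula: "apply_bcontfun (b m) x = (1 + ?u m x) / 2 * apply_bcontfun (a m) x" for m x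
    by (simp add: b_def c_def l1_mult_single_left l1_mult_single_right times_bcontfun.rep_eq
        const_bcontfun.rep_eq apply_int_iterate_alpha[OF hom] cnj_bcontfun.rep_eq field_simps)
  have "compresses b a"
    unfolding compresses_def
  proof (intro conjI allI)
    show "b 0 = a 0"
    proof (rule bcontfun_eqI)
      fix x show "apply_bcontfun (b 0) x = apply_bcontfun (a 0) x"
        using \<theta>[of x] by (simp add: formula complex_norm_square[symmetric])
    qed
    fix m x
    have "cmod (1 + ?u m x) \<le> 2"
      using norm_triangle_ineq[of 1 "?u m x"] by (simp add: norm_mult \<theta>)
    then have "cmod ((1 + ?u m x) / 2) \<le> 1" by (simp add: norm_divide)
    then have "cmod ((1 + ?u m x) / 2) * cmod (apply_bcontfun (a m) x) \<le> 1 * cmod (apply_bcontfun (a m) x)"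
      by (rule mult_right_mono) simp
    then show "cmod (apply_bcontfun (b m) x) \<le> cmod (apply_bcontfun (a m) x)"
      unfolding formula norm_mult by simp
  qed
  with b formula show ?thesis by blast
qed

text \<open>
  Near any given point a sign flip makes the multiplier \<open>(1 + \<theta>(x) cnj (\<theta>(\<sigma>\<^sup>-\<^sup>n x))) / 2\<close> vanish.
  Finitely many of these neighbourhoods cover the space, and the corresponding averages are applied
  one after the other.
\<close>

lemma compress_kills_coefficient:
  assumes I: "l1_ideal \<sigma> I" and n: "\<And>y. y \<noteq> int_iterate \<sigma> (- n) y" and a: "a \<in> I"
  shows "\<exists>b\<in>I. compresses b a \<and> b n = 0"
proof -
  let ?P = "\<lambda>V. \<forall>a\<in>I. \<exists>b\<in>I. compresses b a \<and> (\<forall>x\<in>V. apply_bcontfun (b n) x = 0)"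
  have local: "\<exists>V. open V \<and> y \<in> V \<and> ?P V" for y
  proof -
    obtain V \<theta> where V: "open V" "y \<in> V" and \<theta>: "\<And>x. cmod (apply_bcontfun \<theta> x) = 1"
      and flip: "\<And>x. x \<in> V \<Longrightarrow> apply_bcontfun \<theta> x = 1 \<and> apply_bcontfun \<theta> (int_iterate \<sigma> (- n) x) = - 1"
      using ex_local_sign_flip[OF n[of y]] by blast
    have "?P V"
    proof
      fix a assume "a \<in> I"
      from compress_by_unitary[OF I this \<theta>] obtain b where b: "b \<in> I" "compresses b a"
        and formula: "\<And>m x. apply_bcontfun (b m) x
          = (1 + apply_bcontfun \<theta> x * cnj (apply_bcontfun \<theta> (int_iterate \<sigma> (- m) x))) / 2 * apply_bcontfun (a m) x"
        by blast
      have "apply_bcontfun (b n) x = 0" if "x \<in> V" for x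
        using flip[OF that] by (simp add: formula)
      with b show "\<exists>b\<in>I. compresses b a \<and> (\<forall>x\<in>V. apply_bcontfun (b n) x = 0)" by blast
    qed
    then show ?thesis using V by blast
  qed
  let ?\<C> = "{V. open V \<and> ?P V}"
  have "UNIV \<subseteq> \<Union>?\<C>" using local by blast
  then obtain \<D> where \<D>: "\<D> \<subseteq> ?\<C>" "finite \<D>" "UNIV \<subseteq> \<Union>\<D>"
    by (rule compactE[OF comp]) auto
  have P: "?P (\<Union>\<D>)"
    using \<D>(2,1)
  proof (induction \<D>)
    case empty
    show ?case by (intro ballI bexI) (simp_all add: compresses_def)
  next
    case (insert V \<D>)
    have PV: "?P V" using insert.prems by simp
    have PD: "?P (\<Union>\<D>)" using insert.IH insert.prems by simp
    show ?case
    proof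
      fix a assume "a \<in> I"
      from bspec[OF PD this] obtain b where b: "b \<in> I" "compresses b a" "\<forall>x\<in>\<Union>\<D>. apply_bcontfun (b n) x = 0"
        by blast
      from bspec[OF PV b(1)] obtain c where c: "c \<in> I" "compresses c b" "\<forall>x\<in>V. apply_bcontfun (c n) x = 0"
        by blast
      have "apply_bcontfun (c n) x = 0" if "x \<in> \<Union>(insert V \<D>)" for x
        using that b(3) c(3) compresses_zero[OF c(2)] by (cases "x \<in> V") auto
      with c(1) compresses_trans[OF c(2) b(2)]
      show "\<exists>c\<in>I. compresses c a \<and> (\<forall>x\<in>\<Union>(insert V \<D>). apply_bcontfun (c n) x = 0)" by blast
    qed
  qed
  from bspec[OF P a] obtain b where b: "b \<in> I" "compresses b a" "\<forall>x\<in>\<Union>\<D>. apply_bcontfun (b n) x = 0"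
    by blast
  have "b n = 0" by (rule bcontfun_eqI) (use b(3) \<D>(3) in auto)
  with b show ?thesis by blast
qed

lemma compress_kills_finite:
  assumes I: "l1_ideal \<sigma> I" and free: "\<And>n y. n \<noteq> 0 \<Longrightarrow> y \<noteq> int_iterate \<sigma> (- n) y"
    and a: "a \<in> I" and F: "finite F" "0 \<notin> F"
  shows "\<exists>b\<in>I. compresses b a \<and> (\<forall>n\<in>F. b n = 0)"
  using F
proof (induction F)
  case empty
  show ?case using a by (auto simp: compresses_def)
next
  case (insert n F)
  then obtain b where b: "b \<in> I" "compresses b a" "\<forall>m\<in>F. b m = 0" by auto
  have "n \<noteq> 0" using insert.prems by auto
  from compress_kills_coefficient[OF I free[OF this] b(1)]
  obtain c where c: "c \<in> I" "compresses c b" "c n = 0" by blast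
  have "c m = 0" if "m \<in> F" for m
    by (rule bcontfun_eqI) (use that b(3) c(2) compresses_zero in auto)
  with b c show ?case by (intro bexI[of _ c]) (auto intro: compresses_trans)
qed

text \<open>
  Removing all coefficients in a large finite set other than the zeroth one leaves an element of the
  ideal whose distance from the zeroth term of \<open>a\<close> is bounded by the tail of \<open>a\<close>.
\<close>

lemma zero_coefficient_mem:
  assumes I: "closed_l1_ideal \<sigma> I" and free: "\<And>n y. n \<noteq> 0 \<Longrightarrow> y \<noteq> int_iterate \<sigma> (- n) y" and a: "a \<in> I"
  shows "l1_single 0 (a 0) \<in> I"
proof (rule closed_l1_idealD[OF I l1_single_l1])
  fix e :: real assume "e > 0"
  have I': "l1_ideal \<sigma> I" using I by (simp add: closed_l1_ideal_def)
  then have "a \<in> l1" using a by (auto simp: l1_ideal_def)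
  from l1_tail_small[OF this \<open>e > 0\<close>] obtain F where F: "finite F"
    "\<And>G. finite G \<Longrightarrow> G \<inter> F = {} \<Longrightarrow> (\<Sum>n\<in>G. norm (a n)) \<le> e" by blast
  obtain b where b: "b \<in> I" "compresses b a" "\<forall>n\<in>F - {0}. b n = 0"
    using compress_kills_finite[OF I' free a, of "F - {0}"] F(1) by auto
  have "l1_dist (l1_single 0 (a 0)) b \<le> e"
  proof (rule l1_dist_leI)
    fix G :: "int set" assume G: "finite G"
    have "norm (b n) \<le> norm (a n)" for n
      by (rule norm_bound) (meson b(2) compresses_def norm_bounded order_trans)
    then have "(\<Sum>n\<in>G. norm (l1_single 0 (a 0) n - b n)) \<le> (\<Sum>n\<in>G. if n \<in> F then 0 else norm (a n))"
      using b by (intro sum_mono) (auto simp: l1_single_def compresses_def)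
    also have "\<dots> = (\<Sum>n\<in>G - F. norm (a n))"
      by (rule sum.mono_neutral_cong_right) (use G in auto)
    also have "\<dots> \<le> e" by (rule F(2)) (use G in auto)
    finally show "(\<Sum>n\<in>G. norm (l1_single 0 (a 0) n - b n)) \<le> e" .
  qed
  then show "\<exists>b\<in>I. l1_dist (l1_single 0 (a 0)) b \<le> e" using b(1) by blast
qed

text \<open>
  The conjugate of \<open>f\<close> is approximated uniformly by the multiples
  \<open>f (cnj f)\<^sup>2 / (|f|\<^sup>2 + e\<^sup>2)\<close> of \<open>f\<close>: the error is \<open>|f| e\<^sup>2 / (|f|\<^sup>2 + e\<^sup>2) \<le> e\<close>.
\<close>

lemma single_cnj_mem:
  assumes I: "closed_l1_ideal \<sigma> I" and f: "l1_single 0 f \<in> I"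
  shows "l1_single 0 (cnj_bcontfun f) \<in> I"
proof (rule closed_l1_idealD[OF I l1_single_l1])
  fix e :: real assume e: "e > 0"
  let ?f = "apply_bcontfun f"
  have pos: "(cmod (?f x))\<^sup>2 + e\<^sup>2 > 0" for x using e by (simp add: add_nonneg_pos)
  have "continuous_on UNIV (\<lambda>x. (cnj (?f x))\<^sup>2 / of_real ((cmod (?f x))\<^sup>2 + e\<^sup>2))"
    by (intro continuous_intros continuous_on_apply_bcontfun) (metis pos less_irrefl of_real_eq_0_iff)
  then obtain g where g: "\<And>x. apply_bcontfun g x = (cnj (?f x))\<^sup>2 / of_real ((cmod (?f x))\<^sup>2 + e\<^sup>2)"
    using ex_bcontfun by blast
  let ?b = "l1_mult \<sigma> (l1_single 0 f) (l1_single 0 g)"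
  have b: "?b = l1_single 0 (f * g)"
  proof
    fix n show "?b n = l1_single 0 (f * g) n"
      by (simp add: l1_mult_single_left l1_single_def int_iterate_def)
  qed
  have close: "norm (cnj_bcontfun f - f * g) \<le> e"
  proof (rule norm_bound)
    fix x
    let ?r = "cmod (?f x)"
    have "apply_bcontfun (cnj_bcontfun f - f * g) x = cnj (?f x) - (?f x * cnj (?f x)) * cnj (?f x) / of_real (?r\<^sup>2 + e\<^sup>2)"
      by (simp add: cnj_bcontfun.rep_eq times_bcontfun.rep_eq g power2_eq_square)
    also have "\<dots> = cnj (?f x) * of_real (1 - ?r\<^sup>2 / (?r\<^sup>2 + e\<^sup>2))"
      unfolding complex_norm_square[symmetric] of_real_diff of_real_divide by (simp add: algebra_simps)
    also have "1 - ?r\<^sup>2 / (?r\<^sup>2 + e\<^sup>2) = e\<^sup>2 / (?r\<^sup>2 + e\<^sup>2)"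
      using less_imp_neq[OF pos[of x], symmetric]
      by (simp only: eq_divide_eq left_diff_distrib) simp
    finally have "cmod (apply_bcontfun (cnj_bcontfun f - f * g) x) = ?r * (e\<^sup>2 / (?r\<^sup>2 + e\<^sup>2))"
      using pos[of x] by (simp add: norm_mult del: of_real_divide of_real_add of_real_power)
    also have "\<dots> \<le> e"
    proof -
      have "2 * (?r * e) \<le> ?r\<^sup>2 + e\<^sup>2" using sum_squares_bound[of ?r e] by simp
      then have "?r * e \<le> ?r\<^sup>2 + e\<^sup>2" using e by (smt (verit) mult_nonneg_nonneg norm_ge_zero)
      then have "e * (?r * e) \<le> e * (?r\<^sup>2 + e\<^sup>2)" using e by (intro mult_left_mono) auto
      then show ?thesis using pos[of x] by (simp add: divide_le_eq power2_eq_square mult_ac)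
    qed
    finally show "cmod (apply_bcontfun (cnj_bcontfun f - f * g) x) \<le> e" .
  qed
  have "l1_dist (l1_single 0 (cnj_bcontfun f)) ?b \<le> e"
  proof (rule l1_dist_leI)
    fix G :: "int set" assume G: "finite G"
    have "norm (l1_single 0 (cnj_bcontfun f) n - ?b n) = (if n = 0 then norm (cnj_bcontfun f - f * g) else 0)" for n
      unfolding b by (simp add: l1_single_def)
    then show "(\<Sum>n\<in>G. norm (l1_single 0 (cnj_bcontfun f) n - ?b n)) \<le> e"
      using close e G by simp
  qed
  moreover have "?b \<in> I" using I f by (simp add: closed_l1_ideal_def l1_ideal_def l1_single_l1)
  ultimately show "\<exists>b\<in>I. l1_dist (l1_single 0 (cnj_bcontfun f)) b \<le> e" by blast
qed

lemma l1_star_closed: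
  assumes "a \<in> l1"
  shows "l1_star \<sigma> a \<in> l1"
proof -
  have "bij_betw (\<lambda>n. - n) (UNIV :: int set) UNIV"
    by (rule bij_betw_byWitness[where f' = "\<lambda>n. - n"]) auto
  from summable_on_reindex_bij_betw[OF this, of "\<lambda>n. norm (a n)"] assms
  have "(\<lambda>n. norm (a (- n))) summable_on UNIV" by (simp add: l1_def)
  then show ?thesis
    unfolding l1_def mem_Collect_eq
  proof (rule summable_on_comparison_test)
    show "norm (l1_star \<sigma> a n) \<le> norm (a (- n))" for n
      by (rule norm_bound)
         (simp add: l1_star_def cnj_bcontfun.rep_eq apply_int_iterate_alpha[OF hom] norm_bounded)
  qed simp
qed

text \<open>
  Writing \<open>\<delta>\<close> for the generator, \<open>a(-n)\<close> is the zeroth coefficient of \<open>a \<delta>\<^sup>n\<close>, and the \<open>n\<close>-th term of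
  \<open>a\<^sup>*\<close> is \<open>\<delta>\<^sup>n\<close> times the conjugate of \<open>a(-n)\<close>. So every term of \<open>a\<^sup>*\<close> lies in the ideal, and
  \<open>a\<^sup>*\<close> is the limit of its finite partial sums.
\<close>

lemma free_imp_self_adjoint:
  assumes free: "free_system \<sigma>" and I: "closed_l1_ideal \<sigma> I"
  shows "self_adjoint \<sigma> I"
  unfolding self_adjoint_def
proof
  note bij = bij_of_homeomorphism[OF hom]
  have free': "y \<noteq> int_iterate \<sigma> (- n) y" if "n \<noteq> 0" for n y
  proof
    assume fixed: "y = int_iterate \<sigma> (- n) y"
    have "int_iterate \<sigma> n y = y" using int_iterate_add[OF bij, of n "- n" y] fixed by simp
    then have "(\<sigma> ^^ nat \<bar>n\<bar>) y = y" using fixed that by (cases "n \<ge> 0") (auto simp: int_iterate_def)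
    moreover have "nat \<bar>n\<bar> \<ge> 1" using that by simp
    ultimately show False using free by (auto simp: free_system_def)
  qed
  have I': "l1_ideal \<sigma> I" using I by (simp add: closed_l1_ideal_def)
  fix a assume a: "a \<in> I"
  then have a_l1: "a \<in> l1" using I' by (auto simp: l1_ideal_def)
  have coeff_mem: "l1_single n (l1_star \<sigma> a n) \<in> I" for n
  proof -
    let ?one = "const_bcontfun 1 :: 'a \<Rightarrow>\<^sub>C complex"
    have "l1_mult \<sigma> a (l1_single n ?one) \<in> I" using I' a by (simp add: l1_ideal_def l1_single_l1)
    from zero_coefficient_mem[OF I free' this]
    have "l1_single 0 (l1_mult \<sigma> a (l1_single n ?one) 0) \<in> I" by blast
    moreover have "l1_mult \<sigma> a (l1_single n ?one) 0 = a (- n)"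
      by (rule bcontfun_eqI)
         (simp add: l1_mult_single_right times_bcontfun.rep_eq apply_int_iterate_alpha[OF hom] const_bcontfun.rep_eq)
    ultimately have "l1_single 0 (cnj_bcontfun (a (- n))) \<in> I" using single_cnj_mem[OF I] by simp
    then have "l1_mult \<sigma> (l1_single n ?one) (l1_single 0 (cnj_bcontfun (a (- n)))) \<in> I"
      using I' by (simp add: l1_ideal_def l1_single_l1)
    moreover have "l1_mult \<sigma> (l1_single n ?one) (l1_single 0 (cnj_bcontfun (a (- n)))) = l1_single n (l1_star \<sigma> a n)"
    proof (rule ext, rule bcontfun_eqI)
      fix k x
      show "apply_bcontfun (l1_mult \<sigma> (l1_single n ?one) (l1_single 0 (cnj_bcontfun (a (- n)))) k) x
          = apply_bcontfun (l1_single n (l1_star \<sigma> a n) k) x"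
        by (simp add: l1_mult_single_left times_bcontfun.rep_eq const_bcontfun.rep_eq apply_int_iterate_alpha[OF hom]
            l1_single_def l1_star_def cnj_bcontfun.rep_eq)
    qed
    ultimately show ?thesis by simp
  qed
  have finite_mem: "(\<lambda>n. if n \<in> F then l1_star \<sigma> a n else 0) \<in> I" if "finite F" for F
    using that
  proof (induction F)
    case empty
    then show ?case using I' by (simp add: l1_ideal_def)
  next
    case (insert k F)
    have "(\<lambda>n. (if n \<in> F then l1_star \<sigma> a n else 0) + l1_single k (l1_star \<sigma> a k) n) \<in> I"
      using I' insert coeff_mem by (simp add: l1_ideal_def)
    moreover have "(\<lambda>n. (if n \<in> F then l1_star \<sigma> a n else 0) + l1_single k (l1_star \<sigma> a k) n)
        = (\<lambda>n. if n \<in> insert k F then l1_star \<sigma> a n else 0)"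
      using insert.hyps by (auto simp: l1_single_def)
    ultimately show ?case by simp
  qed
  show "l1_star \<sigma> a \<in> I"
  proof (rule closed_l1_idealD[OF I l1_star_closed[OF a_l1]])
    fix e :: real assume "e > 0"
    from l1_tail_small[OF l1_star_closed[OF a_l1] this] obtain F where F: "finite F"
      "\<And>G. finite G \<Longrightarrow> G \<inter> F = {} \<Longrightarrow> (\<Sum>n\<in>G. norm (l1_star \<sigma> a n)) \<le> e" by blast
    have "l1_dist (l1_star \<sigma> a) (\<lambda>n. if n \<in> F then l1_star \<sigma> a n else 0) \<le> e"
    proof (rule l1_dist_leI)
      fix G :: "int set" assume G: "finite G"
      have "(\<Sum>n\<in>G. norm (l1_star \<sigma> a n - (if n \<in> F then l1_star \<sigma> a n else 0))) = (\<Sum>n\<in>G - F. norm (l1_star \<sigma> a n))"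
        by (rule sum.mono_neutral_cong_right) (use G in auto)
      also have "\<dots> \<le> e" by (rule F(2)) (use G in auto)
      finally show "(\<Sum>n\<in>G. norm (l1_star \<sigma> a n - (if n \<in> F then l1_star \<sigma> a n else 0))) \<le> e" .
    qed
    then show "\<exists>b\<in>I. l1_dist (l1_star \<sigma> a) b \<le> e" using finite_mem[OF F(1)] by blast
  qed
qed

end

theorem theorem4p4:
  fixes \<sigma> :: "'a::t2_space \<Rightarrow> 'a"
  assumes "compact (UNIV :: 'a set)"
    and "homeomorphism UNIV UNIV \<sigma> (inv \<sigma>)"
  shows "(\<forall>I. closed_l1_ideal \<sigma> I \<longrightarrow> self_adjoint \<sigma> I) \<longleftrightarrow> free_system \<sigma>"
  using free_imp_self_adjoint[OF assms] not_free_imp_not_self_adjoint[OF assms(2)] by blast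

end
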